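(* Let $H$ be a Hopf algebra over a field $\Bbbk$ with bijective antipode $S$, let $A$ and $B$ be unital algebras and let $\cdot: A\otimes H^{\mathrm{op}}\to A$ be a right partial action of $H^{\mathrm{op}}$ on $A$. Suppose that $(\varphi,\gamma)$, with $\varphi:A\to B$ and $\gamma:H^{\mathrm{opcop}}\to B$, is an opposite covariant pair associated with these data. Then there exists a unique algebra morphism $\Gamma:\underline{H^{\mathrm{op}}\#A}\to B$ such that $\varphi=\Gamma\circ\varphi_0$ and $\gamma=\Gamma\circ\gamma_0$, where $\varphi_0:A\to\underline{H^{\mathrm{op}}\#A}$, $a\mapsto 1_H\#a$, and $\gamma_0:H^{\mathrm{opcop}}\to\underline{H^{\mathrm{op}}\#A}$, $h\mapsto h\#1_A$.
   Context: Conventions: algebras are associative unital $\Bbbk$-algebras, tensor products are over $\Bbbk$, $\Delta(h)=h_{(1)}\otimes h_{(2)}$. $H^{\mathrm{op}}$ is $H$ with multiplication $h\cdot_{\mathrm{op}}k=kh$ and the same comultiplication. $H^{\mathrm{opcop}}$ is $H$ with opposite multiplication and coopposite comultiplication, written $\Delta_{\mathrm{cop}}(h)=h_{[1]}\otimes h_{[2]}=h_{(2)}\otimes h_{(1)}$; its antipode is $S$. A right partial action (always meant symmetric) of a Hopf algebra $L$ on $A$ is a linear map $A\otimes L\to A$, $a\otimes h\mapsto a\cdot h$, with $a\cdot 1_L=a$; $(ab)\cdot h=(a\cdot h_{(1)})(b\cdot h_{(2)})$; $(a\cdot k)\cdot h=(a\cdot kh_{(1)})(1_A\cdot h_{(2)})=(1_A\cdot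 h_{(1)})(a\cdot kh_{(2)})$ for all $a,b\in A$, $h,k\in L$ (for $L=H^{\mathrm{op}}$ products of elements of $L$ are taken in $H^{\mathrm{op}}$). Right partial smash product: $L\otimes A$ has the associative product $(k\otimes b)(h\otimes a)=kh_{(1)}\otimes(b\cdot h_{(2)})a$; $\underline{L\#A}=(1_L\otimes 1_A)(L\otimes A)$ is the unital algebra spanned by $h\#a=h_{(1)}\otimes(1_A\cdot h_{(2)})a$, with unit $1_L\#1_A$. A partial representation of a Hopf algebra $L$ (antipode $S_L$) in a unital algebra $B$ is a linear map $\pi:L\to B$ with, for all $h,k\in L$: $\pi(1_L)=1_B$; $\pi(h)\pi(k_{(1)})\pi(S_L(k_{(2)}))=\pi(hk_{(1)})\pi(S_L(k_{(2)}))$; $\pi(h_{(1)})\pi(S_L(h_{(2)}))\pi(k)=\pi(h_{(1)})\pi(S_L(h_{(2)})k)$. For $L=H^{\mathrm{opcop}}$ the product, comultiplication and antipode are those of $H^{\mathrm{opcop}}$. An opposite covariant pair associated with $A$, $B$, $H$ and the right partial action of $H^{\mathrm{op}}$ on $A$ is a pair $(\varphi,\gamma)$, where $\varphi:A\to B$ is an algebra morphism and $\gamma:H^{\mathrm{opcop}}\to B$ is a partial representation, such that for all $h\in H^{\mathrm{opcop}}$, $a\in A$: $\varphi(a\cdot h)=\gamma(S^{-1}(h_{[2]}))\varphi(a)\gamma(h_{[1]})$ and $\varphi(a)\gamma(h_{[2]})\gamma(S^{-1}(h_{[1]}))=\gamma(h_{[2]})\gamma(S^{-1}(h_{[1]}))\varphi(a)$.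 *)

theory Defs
  imports "HOL-Algebra.Module" "HOL-Algebra.Generated_Groups" "HOL-Algebra.Free_Abelian_Groups"
begin

section \<open>Algebras and linear maps over a field\<close>

text \<open>
  The locale \<^locale>\<open>algebra\<close> of HOL-Algebra is restricted to commutative algebras. Here
  the algebras are associative and unital; the zero algebra is allowed.
\<close>

locale unital_algebra = K?: field K + M?: module K A + ring A
  for K (structure) and A (structure) +
  assumes smult_mult_left:
      "\<lbrakk>c \<in> carrier K; x \<in> carrier A; y \<in> carrier A\<rbrakk>
        \<Longrightarrow> (c \<odot>\<^bsub>A\<^esub> x) \<otimes>\<^bsub>A\<^esub> y = c \<odot>\<^bsub>A\<^esub> (x \<otimes>\<^bsub>A\<^esub> y)"
    and smult_mult_right:
      "\<lbrakk>c \<in> carrier K; x \<in> carrier A; y \<in> carrier A\<rbrakk>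
        \<Longrightarrow> x \<otimes>\<^bsub>A\<^esub> (c \<odot>\<^bsub>A\<^esub> y) = c \<odot>\<^bsub>A\<^esub> (x \<otimes>\<^bsub>A\<^esub> y)"

definition linear_maps ::
    "('k, 'r) ring_scheme \<Rightarrow> ('k, 'a, 'm) module_scheme \<Rightarrow> ('k, 'b, 'n) module_scheme \<Rightarrow> ('a \<Rightarrow> 'b) set"
  where "linear_maps K M N = {f. f \<in> carrier M \<rightarrow> carrier N \<and>
    (\<forall>x\<in>carrier M. \<forall>y\<in>carrier M. f (x \<oplus>\<^bsub>M\<^esub> y) = f x \<oplus>\<^bsub>N\<^esub> f y) \<and>
    (\<forall>c\<in>carrier K. \<forall>x\<in>carrier M. f (c \<odot>\<^bsub>M\<^esub> x) = c \<odot>\<^bsub>N\<^esub> f x)}"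

definition algebra_morphisms ::
    "('k, 'r) ring_scheme \<Rightarrow> ('k, 'a, 'm) module_scheme \<Rightarrow> ('k, 'b, 'n) module_scheme \<Rightarrow> ('a \<Rightarrow> 'b) set"
  where "algebra_morphisms K A B = ring_hom A B \<inter> linear_maps K A B"

text \<open>The scalar field as a vector space over itself.\<close>

definition scalar_module :: "('k, 'r) ring_scheme \<Rightarrow> ('k, 'k) module"
  where "scalar_module K = \<lparr>carrier = carrier K, mult = mult K, one = one K,
    ring.zero = ring.zero K, add = add K, smult = mult K\<rparr>"


section \<open>Tensor products\<close>

text \<open>
  The tensor product of \<open>M\<close> and \<open>N\<close> over \<open>K\<close> is the free abelian group on
  \<open>carrier M \<times> carrier N\<close> modulo the subgroup generated by the bilinearity and balancing
  relations. Its elements are therefore cosets of formal integer combinations of pairs.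
\<close>

type_synonym ('a, 'b) tensor = "(('a \<times> 'b) \<Rightarrow>\<^sub>0 int) set"

definition tensor_free ::
    "('k, 'a, 'm) module_scheme \<Rightarrow> ('k, 'b, 'n) module_scheme \<Rightarrow> (('a \<times> 'b) \<Rightarrow>\<^sub>0 int) monoid"
  where "tensor_free M N = free_Abelian_group (carrier M \<times> carrier N)"

definition tensor_relations ::
    "('k, 'r) ring_scheme \<Rightarrow> ('k, 'a, 'm) module_scheme \<Rightarrow> ('k, 'b, 'n) module_scheme \<Rightarrow>
      (('a \<times> 'b) \<Rightarrow>\<^sub>0 int) set"
  where "tensor_relations K M N = generate (tensor_free M N)
    ({frag_of (x \<oplus>\<^bsub>M\<^esub> x', y) - frag_of (x, y) - frag_of (x', y) | x x' y.
        x \<in> carrier M \<and> x' \<in> carrier M \<and> y \<in> carrier N} \<union>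
     {frag_of (x, y \<oplus>\<^bsub>N\<^esub> y') - frag_of (x, y) - frag_of (x, y') | x y y'.
        x \<in> carrier M \<and> y \<in> carrier N \<and> y' \<in> carrier N} \<union>
     {frag_of (c \<odot>\<^bsub>M\<^esub> x, y) - frag_of (x, c \<odot>\<^bsub>N\<^esub> y) | c x y.
        c \<in> carrier K \<and> x \<in> carrier M \<and> y \<in> carrier N})"

definition pure_tensor ::
    "('k, 'r) ring_scheme \<Rightarrow> ('k, 'a, 'm) module_scheme \<Rightarrow> ('k, 'b, 'n) module_scheme \<Rightarrow>
      'a \<Rightarrow> 'b \<Rightarrow> ('a, 'b) tensor"
  where "pure_tensor K M N x y = tensor_relations K M N #>\<^bsub>tensor_free M N\<^esub> frag_of (x, y)"

text \<open>
  Only the vector space structure of the tensor product is defined here, so the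
  multiplicative fields of the record are left undefined. Scalars act on representatives
  through the left factor; the cosets in the union below all coincide.
\<close>

definition tensor_product ::
    "('k, 'r) ring_scheme \<Rightarrow> ('k, 'a, 'm) module_scheme \<Rightarrow> ('k, 'b, 'n) module_scheme \<Rightarrow>
      ('k, ('a, 'b) tensor) module"
  where "tensor_product K M N =
    (let Q = tensor_free M N Mod tensor_relations K M N in
     \<lparr>carrier = carrier Q, mult = undefined, one = undefined,
      ring.zero = one Q, add = mult Q,
      smult = (\<lambda>c t. \<Union>z\<in>t. tensor_relations K M N #>\<^bsub>tensor_free M N\<^esub>
        frag_extend (\<lambda>(x, y). frag_of (c \<odot>\<^bsub>M\<^esub> x, y)) z)\<rparr>)"

text \<open>
  For a \<open>K\<close>-bilinear map \<open>f\<close> into \<open>P\<close>, \<open>tensor_lift P f\<close> is the linear map on the tensor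
  product with \<open>x \<otimes> y \<mapsto> f x y\<close>: it evaluates \<open>f\<close> on the formal combinations
  representing the tensor, all of which give the same value.
\<close>

definition tensor_lift ::
    "('k, 'p, 'l) module_scheme \<Rightarrow> ('a \<Rightarrow> 'b \<Rightarrow> 'p) \<Rightarrow> ('a, 'b) tensor \<Rightarrow> 'p"
  where "tensor_lift P f t = the_elem
    ((\<lambda>z. \<Oplus>\<^bsub>P\<^esub>q\<in>Poly_Mapping.keys z. [Poly_Mapping.lookup z q] \<cdot>\<^bsub>P\<^esub> f (fst q) (snd q)) ` t)"


section \<open>Hopf algebras\<close>

record ('k, 'h) hopf_algebra = "('k, 'h) module" +
  comul :: "'h \<Rightarrow> ('h, 'h) tensor"
  counit :: "'h \<Rightarrow> 'k"
  antipode :: "'h \<Rightarrow> 'h"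

text \<open>
  Sweedler notation: \<open>sweedler L P (\<lambda>x y. f x y) h\<close> is the element
  \<open>f h\<^sub>(\<^sub>1\<^sub>) h\<^sub>(\<^sub>2\<^sub>)\<close> of \<open>P\<close>, where \<open>f\<close> is bilinear and \<open>h\<^sub>(\<^sub>1\<^sub>) \<otimes> h\<^sub>(\<^sub>2\<^sub>)\<close> is the
  comultiplication of \<open>L\<close> applied to \<open>h\<close>.
\<close>

definition sweedler ::
    "('k, 'h, 'm) hopf_algebra_scheme \<Rightarrow> ('k, 'p, 'l) module_scheme \<Rightarrow> ('h \<Rightarrow> 'h \<Rightarrow> 'p) \<Rightarrow> 'h \<Rightarrow> 'p"
  where "sweedler L P f h = tensor_lift P f (comul L h)"

locale hopf_algebra = unital_algebra K H for K (structure) and H (structure) +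
  assumes comul_linear: "comul H \<in> linear_maps K H (tensor_product K H H)"
    and counit_linear: "counit H \<in> linear_maps K H (scalar_module K)"
    and antipode_linear: "antipode H \<in> linear_maps K H H"
    and coassoc:
      "h \<in> carrier H \<Longrightarrow>
        sweedler H (tensor_product K H (tensor_product K H H))
          (\<lambda>x y. sweedler H (tensor_product K H (tensor_product K H H))
            (\<lambda>u v. pure_tensor K H (tensor_product K H H) u (pure_tensor K H H v y)) x) h
        = sweedler H (tensor_product K H (tensor_product K H H))
            (\<lambda>x y. pure_tensor K H (tensor_product K H H) x (comul H y)) h"
    and counit_left: "h \<in> carrier H \<Longrightarrow> sweedler H H (\<lambda>x y. counit H x \<odot>\<^bsub>H\<^esub> y) h = h"
    and counit_right: "h \<in> carrier H \<Longrightarrow> sweedler H H (\<lambda>x y. counit H y \<odot>\<^bsub>H\<^esub> x) h = h"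
    and comul_one: "comul H \<one>\<^bsub>H\<^esub> = pure_tensor K H H \<one>\<^bsub>H\<^esub> \<one>\<^bsub>H\<^esub>"
    and comul_mult:
      "\<lbrakk>h \<in> carrier H; k \<in> carrier H\<rbrakk> \<Longrightarrow>
        comul H (h \<otimes>\<^bsub>H\<^esub> k) =
          sweedler H (tensor_product K H H)
            (\<lambda>x y. sweedler H (tensor_product K H H)
              (\<lambda>u v. pure_tensor K H H (x \<otimes>\<^bsub>H\<^esub> u) (y \<otimes>\<^bsub>H\<^esub> v)) k) h"
    and counit_one: "counit H \<one>\<^bsub>H\<^esub> = \<one>\<^bsub>K\<^esub>"
    and counit_mult:
      "\<lbrakk>h \<in> carrier H; k \<in> carrier H\<rbrakk> \<Longrightarrow>
        counit H (h \<otimes>\<^bsub>H\<^esub> k) = counit H h \<otimes>\<^bsub>K\<^esub> counit H k"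
    and antipode_left:
      "h \<in> carrier H \<Longrightarrow>
        sweedler H H (\<lambda>x y. antipode H x \<otimes>\<^bsub>H\<^esub> y) h = counit H h \<odot>\<^bsub>H\<^esub> \<one>\<^bsub>H\<^esub>"
    and antipode_right:
      "h \<in> carrier H \<Longrightarrow>
        sweedler H H (\<lambda>x y. x \<otimes>\<^bsub>H\<^esub> antipode H y) h = counit H h \<odot>\<^bsub>H\<^esub> \<one>\<^bsub>H\<^esub>"

definition antipode_inv :: "('k, 'h, 'm) hopf_algebra_scheme \<Rightarrow> 'h \<Rightarrow> 'h"
  where "antipode_inv H = inv_into (carrier H) (antipode H)"

definition hopf_op :: "('k, 'h, 'm) hopf_algebra_scheme \<Rightarrow> ('k, 'h, 'm) hopf_algebra_scheme"
  where "hopf_op H = H\<lparr>mult := (\<lambda>h k. k \<otimes>\<^bsub>H\<^esub> h), antipode := antipode_inv H\<rparr>"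

definition hopf_opcop ::
    "('k, 'r) ring_scheme \<Rightarrow> ('k, 'h, 'm) hopf_algebra_scheme \<Rightarrow> ('k, 'h, 'm) hopf_algebra_scheme"
  where "hopf_opcop K H = H\<lparr>mult := (\<lambda>h k. k \<otimes>\<^bsub>H\<^esub> h),
    comul := sweedler H (tensor_product K H H) (\<lambda>x y. pure_tensor K H H y x)\<rparr>"


section \<open>Partial actions, smash products, partial representations\<close>

text \<open>
  The linear map \<open>a \<otimes> h \<mapsto> a \<cdot> h\<close> from \<open>A \<otimes> L\<close> to \<open>A\<close> is given as the corresponding
  bilinear map, with \<open>act a h\<close> standing for \<open>a \<cdot> h\<close>.
\<close>

definition right_partial_action ::
    "('k, 'r) ring_scheme \<Rightarrow> ('k, 'h, 'm) hopf_algebra_scheme \<Rightarrow> ('k, 'a, 'n) module_scheme \<Rightarrow>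
      ('a \<Rightarrow> 'h \<Rightarrow> 'a) \<Rightarrow> bool"
  where "right_partial_action K L A act \<longleftrightarrow>
    (\<forall>a\<in>carrier A. (\<lambda>h. act a h) \<in> linear_maps K L A) \<and>
    (\<forall>h\<in>carrier L. (\<lambda>a. act a h) \<in> linear_maps K A A) \<and>
    (\<forall>a\<in>carrier A. act a \<one>\<^bsub>L\<^esub> = a) \<and>
    (\<forall>a\<in>carrier A. \<forall>b\<in>carrier A. \<forall>h\<in>carrier L.
      act (a \<otimes>\<^bsub>A\<^esub> b) h = sweedler L A (\<lambda>x y. act a x \<otimes>\<^bsub>A\<^esub> act b y) h) \<and>
    (\<forall>a\<in>carrier A. \<forall>h\<in>carrier L. \<forall>k\<in>carrier L.
      act (act a k) h
        = sweedler L A (\<lambda>x y. act a (k \<otimes>\<^bsub>L\<^esub> x) \<otimes>\<^bsub>A\<^esub> act \<one>\<^bsub>A\<^esub> y) h) \<and>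
    (\<forall>a\<in>carrier A. \<forall>h\<in>carrier L. \<forall>k\<in>carrier L.
      act (act a k) h
        = sweedler L A (\<lambda>x y. act \<one>\<^bsub>A\<^esub> x \<otimes>\<^bsub>A\<^esub> act a (k \<otimes>\<^bsub>L\<^esub> y)) h)"

text \<open>The product on all of \<open>L \<otimes> A\<close>, which has no unit in general:
  \<open>(k \<otimes> b)(h \<otimes> a) = k h\<^sub>(\<^sub>1\<^sub>) \<otimes> (b \<cdot> h\<^sub>(\<^sub>2\<^sub>)) a\<close>.\<close>

definition smash_mult ::
    "('k, 'r) ring_scheme \<Rightarrow> ('k, 'h, 'm) hopf_algebra_scheme \<Rightarrow> ('k, 'a, 'n) module_scheme \<Rightarrow>
      ('a \<Rightarrow> 'h \<Rightarrow> 'a) \<Rightarrow> ('h, 'a) tensor \<Rightarrow> ('h, 'a) tensor \<Rightarrow> ('h, 'a) tensor"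
  where "smash_mult K L A act s t =
    (let T = tensor_product K L A in
      tensor_lift T (\<lambda>k b. tensor_lift T (\<lambda>h a.
        sweedler L T (\<lambda>x y. pure_tensor K L A (k \<otimes>\<^bsub>L\<^esub> x) (act b y \<otimes>\<^bsub>A\<^esub> a)) h) t) s)"

text \<open>\<open>smash_elem K L A act h a\<close> is \<open>h # a = h\<^sub>(\<^sub>1\<^sub>) \<otimes> (1 \<cdot> h\<^sub>(\<^sub>2\<^sub>)) a\<close>.\<close>

definition smash_elem ::
    "('k, 'r) ring_scheme \<Rightarrow> ('k, 'h, 'm) hopf_algebra_scheme \<Rightarrow> ('k, 'a, 'n) module_scheme \<Rightarrow>
      ('a \<Rightarrow> 'h \<Rightarrow> 'a) \<Rightarrow> 'h \<Rightarrow> 'a \<Rightarrow> ('h, 'a) tensor"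
  where "smash_elem K L A act h a =
    sweedler L (tensor_product K L A) (\<lambda>x y. pure_tensor K L A x (act \<one>\<^bsub>A\<^esub> y \<otimes>\<^bsub>A\<^esub> a)) h"

definition partial_smash_product ::
    "('k, 'r) ring_scheme \<Rightarrow> ('k, 'h, 'm) hopf_algebra_scheme \<Rightarrow> ('k, 'a, 'n) module_scheme \<Rightarrow>
      ('a \<Rightarrow> 'h \<Rightarrow> 'a) \<Rightarrow> ('k, ('h, 'a) tensor) module"
  where "partial_smash_product K L A act = (tensor_product K L A)
    \<lparr>carrier := smash_mult K L A act (pure_tensor K L A \<one>\<^bsub>L\<^esub> \<one>\<^bsub>A\<^esub>) ` carrier (tensor_product K L A),
     mult := smash_mult K L A act,
     one := smash_elem K L A act \<one>\<^bsub>L\<^esub> \<one>\<^bsub>A\<^esub>\<rparr>"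

definition partial_representation ::
    "('k, 'r) ring_scheme \<Rightarrow> ('k, 'h, 'm) hopf_algebra_scheme \<Rightarrow> ('k, 'b, 'n) module_scheme \<Rightarrow>
      ('h \<Rightarrow> 'b) \<Rightarrow> bool"
  where "partial_representation K L B \<pi> \<longleftrightarrow>
    \<pi> \<in> linear_maps K L B \<and>
    \<pi> \<one>\<^bsub>L\<^esub> = \<one>\<^bsub>B\<^esub> \<and>
    (\<forall>h\<in>carrier L. \<forall>k\<in>carrier L.
      sweedler L B (\<lambda>x y. \<pi> h \<otimes>\<^bsub>B\<^esub> \<pi> x \<otimes>\<^bsub>B\<^esub> \<pi> (antipode L y)) k
        = sweedler L B (\<lambda>x y. \<pi> (h \<otimes>\<^bsub>L\<^esub> x) \<otimes>\<^bsub>B\<^esub> \<pi> (antipode L y)) k) \<and>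
    (\<forall>h\<in>carrier L. \<forall>k\<in>carrier L.
      sweedler L B (\<lambda>x y. \<pi> x \<otimes>\<^bsub>B\<^esub> \<pi> (antipode L y) \<otimes>\<^bsub>B\<^esub> \<pi> k) h
        = sweedler L B (\<lambda>x y. \<pi> x \<otimes>\<^bsub>B\<^esub> \<pi> (antipode L y \<otimes>\<^bsub>L\<^esub> k)) h)"

text \<open>In the two identities below \<open>x\<close> and \<open>y\<close> stand for \<open>h\<^sub>[\<^sub>1\<^sub>]\<close> and \<open>h\<^sub>[\<^sub>2\<^sub>]\<close>, the
  Sweedler components with respect to the co-opposite comultiplication.\<close>

definition opposite_covariant_pair ::
    "('k, 'r) ring_scheme \<Rightarrow> ('k, 'h, 'm) hopf_algebra_scheme \<Rightarrow> ('k, 'a, 'n) module_scheme \<Rightarrow>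
      ('k, 'b, 'l) module_scheme \<Rightarrow> ('a \<Rightarrow> 'h \<Rightarrow> 'a) \<Rightarrow> ('a \<Rightarrow> 'b) \<Rightarrow> ('h \<Rightarrow> 'b) \<Rightarrow> bool"
  where "opposite_covariant_pair K H A B act \<phi> \<gamma> \<longleftrightarrow>
    \<phi> \<in> algebra_morphisms K A B \<and>
    partial_representation K (hopf_opcop K H) B \<gamma> \<and>
    (\<forall>h\<in>carrier H. \<forall>a\<in>carrier A.
      \<phi> (act a h) = sweedler (hopf_opcop K H) B
        (\<lambda>x y. \<gamma> (antipode_inv H y) \<otimes>\<^bsub>B\<^esub> \<phi> a \<otimes>\<^bsub>B\<^esub> \<gamma> x) h) \<and>
    (\<forall>h\<in>carrier H. \<forall>a\<in>carrier A.
      sweedler (hopf_opcop K H) B (\<lambda>x y. \<phi> a \<otimes>\<^bsub>B\<^esub> \<gamma> y \<otimes>\<^bsub>B\<^esub> \<gamma> (antipode_inv H x)) h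
        = sweedler (hopf_opcop K H) B (\<lambda>x y. \<gamma> y \<otimes>\<^bsub>B\<^esub> \<gamma> (antipode_inv H x) \<otimes>\<^bsub>B\<^esub> \<phi> a) h)"

end

theory Submission
  imports Defs
begin

text \<open>
  Write \<open>S\<close> for the antipode, \<open>Si\<close> for its inverse and \<open>h\<^sub>1 \<otimes> h\<^sub>2\<close> for the
  comultiplication of \<open>H\<close>. The two conditions \<open>\<phi>(a) = \<Gamma>(1 # a)\<close> and \<open>\<gamma>(h) = \<Gamma>(h # 1)\<close> leave
  one candidate: \<open>h # a = (h # 1)(1 # a)\<close> in the smash product (\<open>smash_factor\<close>), and these elements
  span it, so \<open>\<Gamma>(h # a) = \<gamma>(h)\<phi>(a)\<close>. This gives uniqueness (\<open>Gamma_unique\<close>).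

  For existence, the formula \<open>h \<otimes> a \<mapsto> \<gamma>(h)\<phi>(a)\<close> is bilinear and so defines \<open>\<Gamma>\<close> on the whole tensor
  product. This extension is multiplicative already there, although \<open>H \<otimes> A\<close> has no unit in general: on pure
  tensors the claim is
  \<open>\<gamma>(h\<^sub>1 k) \<phi>(b \<cdot> h\<^sub>2) = \<gamma>(k) \<phi>(b) \<gamma>(h)\<close> (\<open>gamma_phi_act\<close>). Covariance turns the left side into
  \<open>\<gamma>(h\<^sub>1 k) \<gamma>(Si h\<^sub>2) \<phi>(b) \<gamma>(h\<^sub>3)\<close>, and three moves finish the computation:
  \<^item> \<open>\<gamma>(h\<^sub>1 k) \<gamma>(Si h\<^sub>2) = \<gamma>(k) \<gamma>(h\<^sub>1) \<gamma>(Si h\<^sub>2)\<close> (\<open>gamma_mult_absorb\<close>);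
  \<^item> \<open>\<gamma>(h\<^sub>1) \<gamma>(Si h\<^sub>2)\<close> commutes with \<open>\<phi>(b)\<close>, the second covariance condition;
  \<^item> \<open>\<gamma>(h\<^sub>1) \<gamma>(Si h\<^sub>2) \<gamma>(h\<^sub>3) = \<gamma>(h)\<close> (\<open>gamma_regular\<close>).

  The first and third move are consequences of the axioms of a partial representation, but those
  speak about \<open>S\<close>. They are rewritten in terms of \<open>Si\<close> by substituting \<open>Si h\<close> for \<open>h\<close>, which is
  possible because \<open>S\<close>, and with it \<open>Si\<close>, reverses the comultiplication (\<open>sw_antipode\<close>, \<open>sw_Si\<close>).

  Finally \<open>\<Gamma>\<close> has to be restricted to the image of \<open>t \<mapsto> (1 \<otimes> 1) t\<close>. That this image is closed under
  the product follows from \<open>((1 \<otimes> 1) s) t = (1 \<otimes> 1)(s t)\<close> (\<open>smash_unit_assoc\<close>).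
\<close>

section \<open>Linear and bilinear maps\<close>

definition bilinear_maps ::
    "('k, 'r) ring_scheme \<Rightarrow> ('k, 'a, 'm) module_scheme \<Rightarrow> ('k, 'b, 'n) module_scheme \<Rightarrow>
      ('k, 'p, 'l) module_scheme \<Rightarrow> ('a \<Rightarrow> 'b \<Rightarrow> 'p) set"
  where "bilinear_maps K M N P = {f.
    (\<forall>x\<in>carrier M. (\<lambda>y. f x y) \<in> linear_maps K N P) \<and>
    (\<forall>y\<in>carrier N. (\<lambda>x. f x y) \<in> linear_maps K M P)}"

lemma linear_mapsI:
  assumes "\<And>x. x \<in> carrier M \<Longrightarrow> f x \<in> carrier N"
    and "\<And>x y. \<lbrakk>x \<in> carrier M; y \<in> carrier M\<rbrakk> \<Longrightarrow> f (x \<oplus>\<^bsub>M\<^esub> y) = f x \<oplus>\<^bsub>N\<^esub> f y"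
    and "\<And>c x. \<lbrakk>c \<in> carrier K; x \<in> carrier M\<rbrakk> \<Longrightarrow> f (c \<odot>\<^bsub>M\<^esub> x) = c \<odot>\<^bsub>N\<^esub> f x"
  shows "f \<in> linear_maps K M N"
  using assms by (auto simp: linear_maps_def)

lemma linear_closed: "f \<in> linear_maps K M N \<Longrightarrow> x \<in> carrier M \<Longrightarrow> f x \<in> carrier N"
  and linear_add: "f \<in> linear_maps K M N \<Longrightarrow> x \<in> carrier M \<Longrightarrow> y \<in> carrier M \<Longrightarrow>
    f (x \<oplus>\<^bsub>M\<^esub> y) = f x \<oplus>\<^bsub>N\<^esub> f y"
  and linear_smult: "f \<in> linear_maps K M N \<Longrightarrow> c \<in> carrier K \<Longrightarrow> x \<in> carrier M \<Longrightarrow>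
    f (c \<odot>\<^bsub>M\<^esub> x) = c \<odot>\<^bsub>N\<^esub> f x"
  by (auto simp: linear_maps_def)

lemma bilinear_mapsI:
  assumes "\<And>x. x \<in> carrier M \<Longrightarrow> (\<lambda>y. f x y) \<in> linear_maps K N P"
    and "\<And>y. y \<in> carrier N \<Longrightarrow> (\<lambda>x. f x y) \<in> linear_maps K M P"
  shows "f \<in> bilinear_maps K M N P"
  using assms by (auto simp: bilinear_maps_def)

lemma bilinear_left:
    "f \<in> bilinear_maps K M N P \<Longrightarrow> y \<in> carrier N \<Longrightarrow> (\<lambda>x. f x y) \<in> linear_maps K M P"
  and bilinear_right:
    "f \<in> bilinear_maps K M N P \<Longrightarrow> x \<in> carrier M \<Longrightarrow> (\<lambda>y. f x y) \<in> linear_maps K N P"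
  by (auto simp: bilinear_maps_def)

lemma bilinear_closed:
  "f \<in> bilinear_maps K M N P \<Longrightarrow> x \<in> carrier M \<Longrightarrow> y \<in> carrier N \<Longrightarrow> f x y \<in> carrier P"
  using linear_closed[of "\<lambda>y. f x y" K N P y] by (simp add: bilinear_right)

lemma linear_cong:
  assumes "module K M" and f: "f \<in> linear_maps K M N"
    and eq: "\<And>x. x \<in> carrier M \<Longrightarrow> f x = g x"
  shows "g \<in> linear_maps K M N"
proof -
  interpret M: module K M by fact
  show ?thesis
  proof (rule linear_mapsI)
    show "g x \<in> carrier N" if "x \<in> carrier M" for x
      using linear_closed[OF f that] eq[OF that] by simp
    show "g (x \<oplus>\<^bsub>M\<^esub> y) = g x \<oplus>\<^bsub>N\<^esub> g y" if "x \<in> carrier M" "y \<in> carrier M" for x y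
      using linear_add[OF f that] that by (simp add: eq[symmetric])
    show "g (c \<odot>\<^bsub>M\<^esub> x) = c \<odot>\<^bsub>N\<^esub> g x" if "c \<in> carrier K" "x \<in> carrier M" for c x
      using linear_smult[OF f that] that by (simp add: eq[symmetric])
  qed
qed

lemma bilinear_cong:
  assumes "module K M" "module K N" and f: "f \<in> bilinear_maps K M N P"
    and eq: "\<And>x y. x \<in> carrier M \<Longrightarrow> y \<in> carrier N \<Longrightarrow> f x y = g x y"
  shows "g \<in> bilinear_maps K M N P"
proof (rule bilinear_mapsI)
  show "(\<lambda>y. g x y) \<in> linear_maps K N P" if "x \<in> carrier M" for x
    by (rule linear_cong[OF assms(2) bilinear_right[OF f that]]) (rule eq[OF that])
  show "(\<lambda>x. g x y) \<in> linear_maps K M P" if "y \<in> carrier N" for y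
    by (rule linear_cong[OF assms(1) bilinear_left[OF f that]]) (rule eq[OF _ that])
qed

lemma linear_id: "(\<lambda>x. x) \<in> linear_maps K M M"
  by (auto simp: linear_maps_def)

lemma linear_comp:
  "g \<in> linear_maps K N P \<Longrightarrow> f \<in> linear_maps K M N \<Longrightarrow> (\<lambda>x. g (f x)) \<in> linear_maps K M P"
  by (auto simp: linear_maps_def Pi_iff)

lemma bilinear_comp:
  "g \<in> linear_maps K P Q \<Longrightarrow> f \<in> bilinear_maps K M N P \<Longrightarrow>
    (\<lambda>x y. g (f x y)) \<in> bilinear_maps K M N Q"
  by (auto simp: bilinear_maps_def intro: linear_comp)


section \<open>The tensor product\<close>

text \<open>The value of \<open>f\<close> on a formal combination of pairs, as it occurs inside
  \<^const>\<open>tensor_lift\<close>.\<close>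

definition formal_eval :: "('p, 'l) ring_scheme \<Rightarrow> ('a \<Rightarrow> 'b \<Rightarrow> 'p) \<Rightarrow> ('a \<times> 'b \<Rightarrow>\<^sub>0 int) \<Rightarrow> 'p"
  where "formal_eval P f z =
    (\<Oplus>\<^bsub>P\<^esub>q\<in>Poly_Mapping.keys z. [Poly_Mapping.lookup z q] \<cdot>\<^bsub>P\<^esub> f (fst q) (snd q))"

context abelian_group
begin

text \<open>Over a common finite index set the evaluations of two formal combinations
  can be added termwise, although their supports differ.\<close>

lemma formal_eval_superset:
  assumes "finite Q" "Poly_Mapping.keys z \<subseteq> Q"
    and "\<And>q. q \<in> Q \<Longrightarrow> f (fst q) (snd q) \<in> carrier G"
  shows "formal_eval G f z = (\<Oplus>q\<in>Q. [Poly_Mapping.lookup z q] \<cdot> f (fst q) (snd q))"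
proof -
  have "[(0::int)] \<cdot> x = \<zero>" for x by (simp add: add_pow_def)
  then show ?thesis
    unfolding formal_eval_def using assms
    by (intro add.finprod_mono_neutral_cong_left) (auto simp: in_keys_iff)
qed

lemma formal_eval_closed:
  assumes "\<And>q. q \<in> Poly_Mapping.keys z \<Longrightarrow> f (fst q) (snd q) \<in> carrier G"
  shows "formal_eval G f z \<in> carrier G"
  unfolding formal_eval_def using assms by (intro add.finprod_closed) auto

lemma formal_eval_add:
  assumes "\<And>q. q \<in> Poly_Mapping.keys z \<union> Poly_Mapping.keys w \<Longrightarrow> f (fst q) (snd q) \<in> carrier G"
  shows "formal_eval G f (z + w) = formal_eval G f z \<oplus> formal_eval G f w"
proof -
  let ?Q = "Poly_Mapping.keys z \<union> Poly_Mapping.keys w"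
  have "formal_eval G f (z + w) = (\<Oplus>q\<in>?Q. [Poly_Mapping.lookup (z + w) q] \<cdot> f (fst q) (snd q))"
    using assms keys_add[of z w] by (intro formal_eval_superset) auto
  also have "\<dots> = (\<Oplus>q\<in>?Q. [Poly_Mapping.lookup z q] \<cdot> f (fst q) (snd q)
      \<oplus> [Poly_Mapping.lookup w q] \<cdot> f (fst q) (snd q))"
    using assms by (intro add.finprod_cong) (auto simp: lookup_add add.int_pow_mult)
  also have "\<dots> = (\<Oplus>q\<in>?Q. [Poly_Mapping.lookup z q] \<cdot> f (fst q) (snd q))
      \<oplus> (\<Oplus>q\<in>?Q. [Poly_Mapping.lookup w q] \<cdot> f (fst q) (snd q))"
    using assms by (intro add.finprod_multf) auto
  also have "\<dots> = formal_eval G f z \<oplus> formal_eval G f w"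
    using assms formal_eval_superset[of ?Q z f] formal_eval_superset[of ?Q w f] by simp
  finally show ?thesis .
qed

lemma formal_eval_zero: "formal_eval G f 0 = \<zero>"
  by (simp add: formal_eval_def)

lemma formal_eval_frag_of:
  "f x y \<in> carrier G \<Longrightarrow> formal_eval G f (frag_of (x, y)) = f x y"
  by (simp add: formal_eval_def keys_frag_of)

lemma formal_eval_diff:
  assumes "\<And>q. q \<in> Poly_Mapping.keys z \<union> Poly_Mapping.keys w \<Longrightarrow> f (fst q) (snd q) \<in> carrier G"
  shows "formal_eval G f (z - w) = formal_eval G f z \<ominus> formal_eval G f w"
proof -
  have "formal_eval G f (z - w + w) = formal_eval G f (z - w) \<oplus> formal_eval G f w"
    using assms keys_diff[of z w] by (intro formal_eval_add) blast
  moreover have "formal_eval G f (z - w) \<in> carrier G" "formal_eval G f w \<in> carrier G"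
    using assms keys_diff[of z w] by (intro formal_eval_closed; blast)+
  ultimately show ?thesis
    by (simp add: a_minus_def add.m_assoc r_neg)
qed

end

locale module_pair = M: module K M + N: module K N
  for K :: "('k, 'r) ring_scheme" (structure) and M (structure) and N (structure)
begin

abbreviation free_group where "free_group \<equiv> tensor_free M N"
abbreviation relators where "relators \<equiv> tensor_relations K M N"
abbreviation coset where "coset z \<equiv> relators #>\<^bsub>free_group\<^esub> z"
abbreviation T where "T \<equiv> tensor_product K M N"
abbreviation pure (infix \<open>\<star>\<close> 72) where "x \<star> y \<equiv> pure_tensor K M N x y"

lemma carrier_free: "z \<in> carrier free_group \<longleftrightarrow> Poly_Mapping.keys z \<subseteq> carrier M \<times> carrier N"
  and mult_free: "z \<otimes>\<^bsub>free_group\<^esub> w = z + w"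
  and one_free: "\<one>\<^bsub>free_group\<^esub> = 0"
  by (simp_all add: tensor_free_def)

lemma comm_group_free: "comm_group free_group"
  by (simp add: tensor_free_def abelian_free_Abelian_group)

lemma group_free: "group free_group"
  by (simp add: tensor_free_def)

lemma inv_free: "z \<in> carrier free_group \<Longrightarrow> inv\<^bsub>free_group\<^esub> z = - z"
  by (simp add: tensor_free_def)

lemma frag_of_free: "x \<in> carrier M \<Longrightarrow> y \<in> carrier N \<Longrightarrow> frag_of (x, y) \<in> carrier free_group"
  by (simp add: carrier_free keys_frag_of)

lemma add_free: "z \<in> carrier free_group \<Longrightarrow> w \<in> carrier free_group \<Longrightarrow> z + w \<in> carrier free_group"
  and diff_free: "z \<in> carrier free_group \<Longrightarrow> w \<in> carrier free_group \<Longrightarrow> z - w \<in> carrier free_group"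
  using keys_add[of z w] keys_diff[of z w] by (auto simp: carrier_free)

text \<open>Induction over the subgroup of relators. The membership in the free group is carried along
  because the steps for negatives and sums need it.\<close>

lemma relator_cases [consumes 1, case_names left right balance zero minus plus]:
  assumes "r \<in> relators"
    and "\<And>x x' y. \<lbrakk>x \<in> carrier M; x' \<in> carrier M; y \<in> carrier N\<rbrakk> \<Longrightarrow>
      P (frag_of (x \<oplus>\<^bsub>M\<^esub> x', y) - frag_of (x, y) - frag_of (x', y))"
    and "\<And>x y y'. \<lbrakk>x \<in> carrier M; y \<in> carrier N; y' \<in> carrier N\<rbrakk> \<Longrightarrow>
      P (frag_of (x, y \<oplus>\<^bsub>N\<^esub> y') - frag_of (x, y) - frag_of (x, y'))"
    and "\<And>c x y. \<lbrakk>c \<in> carrier K; x \<in> carrier M; y \<in> carrier N\<rbrakk> \<Longrightarrow>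
      P (frag_of (c \<odot>\<^bsub>M\<^esub> x, y) - frag_of (x, c \<odot>\<^bsub>N\<^esub> y))"
    and "P 0" and "\<And>z. z \<in> carrier free_group \<Longrightarrow> P z \<Longrightarrow> P (- z)"
    and "\<And>z w. z \<in> carrier free_group \<Longrightarrow> w \<in> carrier free_group \<Longrightarrow> P z \<Longrightarrow> P w \<Longrightarrow> P (z + w)"
  shows "r \<in> carrier free_group \<and> P r"
  using assms(1) unfolding tensor_relations_def
proof (induction r rule: generate.induct)
  case one
  then show ?case using assms(5) by (simp add: one_free carrier_free)
next
  case (incl h)
  then show ?case using assms(2-4)
    by (auto intro!: diff_free frag_of_free)
next
  case (inv h)
  then have h: "h \<in> carrier free_group" "P h" using assms(2-4)
    by (auto intro!: diff_free frag_of_free)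
  then show ?case using assms(6)[OF h] by (simp add: inv_free) (simp add: carrier_free)
next
  case (eng h1 h2)
  then show ?case using assms(7) by (simp add: mult_free add_free)
qed

lemma subgroup_relators: "subgroup relators free_group"
  unfolding tensor_relations_def
  by (rule group.generate_is_subgroup[OF group_free]) (auto intro!: diff_free frag_of_free)

lemma normal_relators: "relators \<lhd> free_group"
  using comm_group.normal_iff_subgroup[OF comm_group_free] subgroup_relators by blast

lemma relators_free: "r \<in> relators \<Longrightarrow> r \<in> carrier free_group"
  using subgroup.mem_carrier[OF subgroup_relators] .

lemma generator_relators:
  shows "\<lbrakk>x \<in> carrier M; x' \<in> carrier M; y \<in> carrier N\<rbrakk> \<Longrightarrow>
      frag_of (x \<oplus>\<^bsub>M\<^esub> x', y) - frag_of (x, y) - frag_of (x', y) \<in> relators"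
    and "\<lbrakk>x \<in> carrier M; y \<in> carrier N; y' \<in> carrier N\<rbrakk> \<Longrightarrow>
      frag_of (x, y \<oplus>\<^bsub>N\<^esub> y') - frag_of (x, y) - frag_of (x, y') \<in> relators"
    and "\<lbrakk>c \<in> carrier K; x \<in> carrier M; y \<in> carrier N\<rbrakk> \<Longrightarrow>
      frag_of (c \<odot>\<^bsub>M\<^esub> x, y) - frag_of (x, c \<odot>\<^bsub>N\<^esub> y) \<in> relators"
  unfolding tensor_relations_def by (rule generate.incl; blast)+

lemma coset_def': "coset z = (\<lambda>r. r + z) ` relators"
  by (auto simp: r_coset_def mult_free)

lemma coset_eqI:
  assumes "z - w \<in> relators" and w: "w \<in> carrier free_group"
  shows "coset z = coset w"
proof -
  have "z \<in> coset w" using assms by (auto simp: coset_def' intro!: image_eqI[of _ _ "z - w"])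
  then show ?thesis
    using group.repr_independence[OF group_free _ w subgroup_relators] by simp
qed

lemma carrier_T: "carrier T = coset ` carrier free_group"
  by (simp add: tensor_product_def Let_def carrier_FactGroup)

lemma coset_closed: "z \<in> carrier free_group \<Longrightarrow> coset z \<in> carrier T"
  by (simp add: carrier_T)

lemma add_coset:
  "z \<in> carrier free_group \<Longrightarrow> w \<in> carrier free_group \<Longrightarrow> coset z \<oplus>\<^bsub>T\<^esub> coset w = coset (z + w)"
  using normal.rcos_sum[OF normal_relators, of z w]
  by (simp add: tensor_product_def Let_def mult_free)

lemma zero_coset: "\<zero>\<^bsub>T\<^esub> = coset 0"
  using group.coset_join2[OF group_free, of 0 relators] subgroup_relators
    subgroup.one_closed[OF subgroup_relators]
  by (simp add: tensor_product_def Let_def carrier_free one_free)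

lemma abelian_group_T: "abelian_group T"
proof -
  interpret Q: comm_group "free_group Mod relators"
    by (rule comm_group.abelian_FactGroup[OF comm_group_free subgroup_relators])
  have eq: "carrier T = carrier (free_group Mod relators)" "add T = mult (free_group Mod relators)"
    "\<zero>\<^bsub>T\<^esub> = \<one>\<^bsub>free_group Mod relators\<^esub>"
    by (simp_all add: tensor_product_def Let_def)
  show ?thesis
    by (rule abelian_groupI; unfold eq)
      (auto simp: Q.m_ac simp del: mult_FactGroup one_FactGroup intro: Q.l_inv_ex)
qed

text \<open>Scaling the left entries of a formal combination maps relators to relators,
  so it does not matter which representative of a tensor is scaled.\<close>

abbreviation scale where "scale c \<equiv> frag_extend (\<lambda>(x, y). frag_of (c \<odot>\<^bsub>M\<^esub> x, y))"

lemma scale_closed: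
  "c \<in> carrier K \<Longrightarrow> z \<in> carrier free_group \<Longrightarrow> scale c z \<in> carrier free_group"
  using keys_frag_extend[of "\<lambda>(x, y). frag_of (c \<odot>\<^bsub>M\<^esub> x, y)" z]
  by (fastforce simp: carrier_free keys_frag_of split: prod.splits)

lemma scale_relators:
  assumes c: "c \<in> carrier K" and r: "r \<in> relators"
  shows "scale c r \<in> relators"
proof -
  note sub = subgroup_relators
  have "r \<in> carrier free_group \<and> scale c r \<in> relators"
    using r
  proof (induction r rule: relator_cases)
    case (left x x' y)
    then show ?case using c generator_relators(1)[of "c \<odot>\<^bsub>M\<^esub> x" "c \<odot>\<^bsub>M\<^esub> x'" y]
      by (simp add: frag_extend_diff M.smult_r_distr)
  next
    case (right x y y')
    then show ?case using c generator_relators(2)[of "c \<odot>\<^bsub>M\<^esub> x" y y']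
      by (simp add: frag_extend_diff)
  next
    case (balance d x y)
    then have "c \<odot>\<^bsub>M\<^esub> (d \<odot>\<^bsub>M\<^esub> x) = d \<odot>\<^bsub>M\<^esub> (c \<odot>\<^bsub>M\<^esub> x)"
      using c by (metis M.smult_assoc1 M.R.m_comm)
    then show ?case using c balance generator_relators(3)[of d "c \<odot>\<^bsub>M\<^esub> x" y]
      by (simp add: frag_extend_diff)
  next
    case zero
    then show ?case using subgroup.one_closed[OF sub] by (simp add: one_free)
  next
    case (minus z)
    then show ?case
      using subgroup.m_inv_closed[OF sub, of "scale c z"] inv_free[of "scale c z"]
      by (simp add: frag_extend_minus relators_free)
  next
    case (plus z w)
    then show ?case using subgroup.m_closed[OF sub, of "scale c z" "scale c w"]
      by (simp add: frag_extend_add mult_free)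
  qed
  then show ?thesis by simp
qed

lemma smult_coset:
  assumes c: "c \<in> carrier K" and z: "z \<in> carrier free_group"
  shows "c \<odot>\<^bsub>T\<^esub> coset z = coset (scale c z)"
proof -
  have eq: "coset (scale c w) = coset (scale c z)" if "w \<in> coset z" for w
  proof (rule coset_eqI)
    show "scale c w - scale c z \<in> relators"
      using that scale_relators[OF c] by (auto simp: coset_def' frag_extend_add)
  qed (rule scale_closed[OF c z])
  have "c \<odot>\<^bsub>T\<^esub> coset z = (\<Union>w\<in>coset z. coset (scale c w))"
    by (simp add: tensor_product_def Let_def)
  also have "\<dots> = (\<Union>w\<in>coset z. coset (scale c z))"
    by (rule SUP_cong[OF refl]) (rule eq)
  also have "\<dots> = coset (scale c z)"
    using group.rcos_self[OF group_free z subgroup_relators] by (intro UN_constant_eq ballI refl)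
  finally show ?thesis .
qed

lemma pure_coset: "x \<star> y = coset (frag_of (x, y))"
  by (simp add: pure_tensor_def)

lemma pure_closed: "x \<in> carrier M \<Longrightarrow> y \<in> carrier N \<Longrightarrow> x \<star> y \<in> carrier T"
  by (simp add: pure_coset coset_closed frag_of_free)

lemma pure_add_left:
  assumes "x \<in> carrier M" "x' \<in> carrier M" "y \<in> carrier N"
  shows "(x \<oplus>\<^bsub>M\<^esub> x') \<star> y = x \<star> y \<oplus>\<^bsub>T\<^esub> x' \<star> y"
  unfolding pure_coset
  using assms generator_relators(1)[OF assms]
  by (subst add_coset) (auto intro!: coset_eqI add_free frag_of_free simp: diff_diff_eq)

lemma pure_add_right:
  assumes "x \<in> carrier M" "y \<in> carrier N" "y' \<in> carrier N"
  shows "x \<star> (y \<oplus>\<^bsub>N\<^esub> y') = x \<star> y \<oplus>\<^bsub>T\<^esub> x \<star> y'"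
  unfolding pure_coset
  using assms generator_relators(2)[OF assms]
  by (subst add_coset) (auto intro!: coset_eqI add_free frag_of_free simp: diff_diff_eq)

lemma smult_pure_left:
  assumes "c \<in> carrier K" "x \<in> carrier M" "y \<in> carrier N"
  shows "c \<odot>\<^bsub>T\<^esub> x \<star> y = (c \<odot>\<^bsub>M\<^esub> x) \<star> y"
  using assms by (simp add: pure_coset smult_coset frag_of_free)

lemma smult_pure_right:
  assumes "c \<in> carrier K" "x \<in> carrier M" "y \<in> carrier N"
  shows "c \<odot>\<^bsub>T\<^esub> x \<star> y = x \<star> (c \<odot>\<^bsub>N\<^esub> y)"
  using assms generator_relators(3)[OF assms]
  by (simp add: smult_pure_left) (auto simp: pure_coset intro!: coset_eqI frag_of_free)

lemma pure_zero:
  assumes "y \<in> carrier N"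
  shows "\<zero>\<^bsub>M\<^esub> \<star> y = \<zero>\<^bsub>T\<^esub>"
proof -
  interpret T: abelian_group T by (rule abelian_group_T)
  have "\<zero>\<^bsub>M\<^esub> \<star> y \<oplus>\<^bsub>T\<^esub> \<zero>\<^bsub>M\<^esub> \<star> y = \<zero>\<^bsub>M\<^esub> \<star> y"
    using pure_add_left[of "\<zero>\<^bsub>M\<^esub>" "\<zero>\<^bsub>M\<^esub>" y] assms by simp
  then show ?thesis using pure_closed[of "\<zero>\<^bsub>M\<^esub>" y] assms
    by (simp add: T.add.l_cancel_one)
qed

text \<open>Every tensor is a sum of pure tensors: negatives are not needed as a separate step,
  since \<open>- (x \<otimes> y) = (- x) \<otimes> y\<close>. The proof therefore tracks a formal combination
  together with its negative.\<close>

lemma tensor_induct [consumes 1, case_names pure add]: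
  assumes t: "t \<in> carrier T"
    and pure: "\<And>x y. x \<in> carrier M \<Longrightarrow> y \<in> carrier N \<Longrightarrow> P (x \<star> y)"
    and add: "\<And>s t. \<lbrakk>s \<in> carrier T; t \<in> carrier T; P s; P t\<rbrakk> \<Longrightarrow> P (s \<oplus>\<^bsub>T\<^esub> t)"
  shows "P t"
proof -
  have "P (coset (- z)) \<and> P (coset z) \<and> z \<in> carrier free_group" if "z \<in> carrier free_group" for z
    using that unfolding carrier_free
  proof (induction z rule: frag_induction)
    case zero
    then show ?case using pure[of "\<zero>\<^bsub>M\<^esub>" "\<zero>\<^bsub>N\<^esub>"] pure_zero[of "\<zero>\<^bsub>N\<^esub>"]
      by (simp add: zero_coset carrier_free)
  next
    case (one p)
    then obtain x y where p: "p = (x, y)" "x \<in> carrier M" "y \<in> carrier N" by auto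
    have cl: "frag_of (\<ominus>\<^bsub>M\<^esub> x, y) \<in> carrier free_group" "- frag_of (x, y) \<in> carrier free_group"
      using p by (auto simp: frag_of_free) (simp add: carrier_free keys_frag_of)
    have "frag_of (\<zero>\<^bsub>M\<^esub>, y) - frag_of (\<ominus>\<^bsub>M\<^esub> x, y) - frag_of (x, y) \<in> relators"
      using generator_relators(1)[of "\<ominus>\<^bsub>M\<^esub> x" x y] p by (simp add: M.l_neg)
    moreover have "frag_of (\<zero>\<^bsub>M\<^esub>, y) \<in> relators"
    proof -
      \<comment> \<open>additivity for \<open>0 + 0\<close> reduces to minus the generator \<open>(0, y)\<close>\<close>
      have r: "frag_of (\<zero>\<^bsub>M\<^esub>, y) - frag_of (\<zero>\<^bsub>M\<^esub>, y) - frag_of (\<zero>\<^bsub>M\<^esub>, y) \<in> relators"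
        using generator_relators(1)[of "\<zero>\<^bsub>M\<^esub>" "\<zero>\<^bsub>M\<^esub>" y] p by simp
      from subgroup.m_inv_closed[OF subgroup_relators r] show ?thesis
        using p by (simp add: inv_free[OF relators_free[OF r]] inv_free[of "- frag_of (\<zero>\<^bsub>M\<^esub>, y)"]
            carrier_free keys_frag_of)
    qed
    ultimately have "- frag_of (x, y) - frag_of (\<ominus>\<^bsub>M\<^esub> x, y) \<in> relators"
      using subgroup.m_closed[OF subgroup_relators, of
        "frag_of (\<zero>\<^bsub>M\<^esub>, y) - frag_of (\<ominus>\<^bsub>M\<^esub> x, y) - frag_of (x, y)" "- frag_of (\<zero>\<^bsub>M\<^esub>, y)"]
        subgroup.m_inv_closed[OF subgroup_relators, of "frag_of (\<zero>\<^bsub>M\<^esub>, y)"]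
        inv_free[of "frag_of (\<zero>\<^bsub>M\<^esub>, y)"] p
      by (simp add: mult_free frag_of_free algebra_simps)
    then have "coset (- frag_of (x, y)) = coset (frag_of (\<ominus>\<^bsub>M\<^esub> x, y))"
      using cl by (intro coset_eqI)
    then show ?case using pure[of x y] pure[of "\<ominus>\<^bsub>M\<^esub> x" y] p frag_of_free[of x y]
      by (simp add: pure_coset)
  next
    case (diff a b)
    then have cl: "- a \<in> carrier free_group" "- b \<in> carrier free_group" "b - a \<in> carrier free_group"
       "a - b \<in> carrier free_group"
      using diff_free[of a b] diff_free[of b a] by (simp_all add: carrier_free)
    have "coset (a - b) = coset a \<oplus>\<^bsub>T\<^esub> coset (- b)" "coset (b - a) = coset b \<oplus>\<^bsub>T\<^esub> coset (- a)"
      using diff cl add_coset[of a "- b"] add_coset[of b "- a"] by (simp_all add: carrier_free)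
    then show ?case using diff add cl by (simp add: coset_closed carrier_free[symmetric])
  qed
  then show ?thesis using t by (auto simp: carrier_T)
qed

lemma module_T: "module K T"
proof (rule moduleI)
  interpret T: abelian_group T by (rule abelian_group_T)
  show "cring K" by (rule M.R.is_cring)
  show "abelian_group T" by (rule abelian_group_T)
  show cl: "c \<odot>\<^bsub>T\<^esub> t \<in> carrier T" if "c \<in> carrier K" "t \<in> carrier T" for c t
    using that by (auto simp: carrier_T smult_coset intro: scale_closed)
  show rd: "c \<odot>\<^bsub>T\<^esub> (s \<oplus>\<^bsub>T\<^esub> t) = c \<odot>\<^bsub>T\<^esub> s \<oplus>\<^bsub>T\<^esub> c \<odot>\<^bsub>T\<^esub> t"
    if "c \<in> carrier K" "s \<in> carrier T" "t \<in> carrier T" for c s t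
    using that by (auto simp: carrier_T smult_coset add_coset add_free scale_closed frag_extend_add)
  show "(c \<oplus>\<^bsub>K\<^esub> d) \<odot>\<^bsub>T\<^esub> t = c \<odot>\<^bsub>T\<^esub> t \<oplus>\<^bsub>T\<^esub> d \<odot>\<^bsub>T\<^esub> t"
    if "c \<in> carrier K" "d \<in> carrier K" "t \<in> carrier T" for c d t
    using that(3)
  proof (induction t rule: tensor_induct)
    case (pure x y)
    then show ?case using that
      by (simp add: smult_pure_left M.smult_l_distr pure_add_left)
  next
    case (add s t)
    then show ?case using that cl by (simp add: rd T.add.m_ac)
  qed
  show "(c \<otimes>\<^bsub>K\<^esub> d) \<odot>\<^bsub>T\<^esub> t = c \<odot>\<^bsub>T\<^esub> (d \<odot>\<^bsub>T\<^esub> t)"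
    if "c \<in> carrier K" "d \<in> carrier K" "t \<in> carrier T" for c d t
    using that(3)
  proof (induction t rule: tensor_induct)
    case (pure x y)
    then show ?case using that by (simp add: smult_pure_left M.smult_assoc1)
  next
    case (add s t)
    then show ?case using that cl by (simp add: rd)
  qed
  show "\<one>\<^bsub>K\<^esub> \<odot>\<^bsub>T\<^esub> t = t" if "t \<in> carrier T" for t
    using that
  proof (induction t rule: tensor_induct)
    case (pure x y)
    then show ?case by (simp add: smult_pure_left)
  next
    case (add s t)
    then show ?case by (simp add: rd)
  qed
qed

lemma pure_bilinear: "(\<lambda>x y. x \<star> y) \<in> bilinear_maps K M N T"
  by (intro bilinear_mapsI linear_mapsI)
    (auto simp: pure_closed pure_add_left pure_add_right smult_pure_left smult_pure_right[symmetric])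

lemma linear_eq_on_pure:
  assumes "f \<in> linear_maps K T P" "g \<in> linear_maps K T P"
    and "\<And>x y. x \<in> carrier M \<Longrightarrow> y \<in> carrier N \<Longrightarrow> f (x \<star> y) = g (x \<star> y)"
    and "t \<in> carrier T"
  shows "f t = g t"
  using assms(4)
  by (induction t rule: tensor_induct)
    (simp_all add: assms(3) linear_add[OF assms(1)] linear_add[OF assms(2)])

text \<open>Bilinear maps kill the relators; this is what makes \<^const>\<open>tensor_lift\<close> well defined.\<close>

context
  fixes P :: "('k, 'p, 'l) module_scheme" and f
  assumes P: "module K P" and f: "f \<in> bilinear_maps K M N P"
begin

interpretation P: module K P by (rule P)

lemma formal_eval_relator:
  assumes r: "r \<in> relators"
  shows "formal_eval P f r = \<zero>\<^bsub>P\<^esub>"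
proof -
  note fl = bilinear_left[OF f] and fr = bilinear_right[OF f]
  have cl: "f (fst q) (snd q) \<in> carrier P"
    if "q \<in> Poly_Mapping.keys z" "z \<in> carrier free_group" for q z
    using that bilinear_closed[OF f, of "fst q" "snd q"] by (auto simp: carrier_free)
  have ev: "formal_eval P f (frag_of (x, y)) = f x y" if "x \<in> carrier M" "y \<in> carrier N" for x y
    by (rule P.formal_eval_frag_of) (rule bilinear_closed[OF f that])
  have diff: "formal_eval P f (z - w) = formal_eval P f z \<ominus>\<^bsub>P\<^esub> formal_eval P f w"
    if "z \<in> carrier free_group" "w \<in> carrier free_group" for z w
    using that by (intro P.formal_eval_diff) (auto intro: cl)
  have cancel: "a \<oplus>\<^bsub>P\<^esub> b \<ominus>\<^bsub>P\<^esub> a \<ominus>\<^bsub>P\<^esub> b = \<zero>\<^bsub>P\<^esub>" if "a \<in> carrier P" "b \<in> carrier P" for a b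
  proof -
    have "a \<oplus>\<^bsub>P\<^esub> b \<ominus>\<^bsub>P\<^esub> a \<ominus>\<^bsub>P\<^esub> b = (a \<oplus>\<^bsub>P\<^esub> b) \<oplus>\<^bsub>P\<^esub> (\<ominus>\<^bsub>P\<^esub> a \<oplus>\<^bsub>P\<^esub> \<ominus>\<^bsub>P\<^esub> b)"
      using that by (simp add: a_minus_def P.add.m_assoc)
    then show ?thesis using that by (simp add: P.minus_add[symmetric] P.r_neg del: P.minus_add)
  qed
  have "r \<in> carrier free_group \<and> formal_eval P f r = \<zero>\<^bsub>P\<^esub>"
    using r
  proof (induction r rule: relator_cases)
    case (left x x' y)
    then show ?case
      by (simp add: diff diff_free frag_of_free ev linear_add[OF fl] cancel bilinear_closed[OF f])
  next
    case (right x y y')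
    then show ?case
      by (simp add: diff diff_free frag_of_free ev linear_add[OF fr] cancel bilinear_closed[OF f])
  next
    case (balance c x y)
    then show ?case
      by (simp add: diff frag_of_free ev linear_smult[OF fl] linear_smult[OF fr]
          bilinear_closed[OF f] P.add.r_inv a_minus_def)
  next
    case zero
    then show ?case by (rule P.formal_eval_zero)
  next
    case (minus z)
    have "0 \<in> carrier free_group" by (simp add: carrier_free)
    from diff[OF this \<open>z \<in> carrier free_group\<close>] minus(2) show ?case
      by (simp add: P.formal_eval_zero a_minus_def)
  next
    case (plus z w)
    have "formal_eval P f (z + w) = formal_eval P f z \<oplus>\<^bsub>P\<^esub> formal_eval P f w"
      by (rule P.formal_eval_add) (use cl plus(1,2) in blast)
    then show ?case using plus(3,4) by simp
  qed
  then show ?thesis by simp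
qed

lemma tensor_lift_coset:
  assumes z: "z \<in> carrier free_group"
  shows "tensor_lift P f (coset z) = formal_eval P f z"
proof -
  have cl: "f (fst q) (snd q) \<in> carrier P"
    if "q \<in> Poly_Mapping.keys z" "z \<in> carrier free_group" for q z
    using that bilinear_closed[OF f, of "fst q" "snd q"] by (auto simp: carrier_free)
  have "formal_eval P f (r + z) = formal_eval P f z" if r: "r \<in> relators" for r
  proof -
    have "formal_eval P f (r + z) = formal_eval P f r \<oplus>\<^bsub>P\<^esub> formal_eval P f z"
      by (rule P.formal_eval_add) (use cl z relators_free[OF r] in blast)
    moreover have "formal_eval P f z \<in> carrier P"
      by (rule P.formal_eval_closed) (rule cl[OF _ z])
    ultimately show ?thesis by (simp add: formal_eval_relator[OF r])
  qed
  then have "formal_eval P f ` coset z = (\<lambda>r. formal_eval P f z) ` relators"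
    unfolding coset_def' image_image by (rule image_cong[OF refl])
  also have "\<dots> = {formal_eval P f z}"
    using subgroup.one_closed[OF subgroup_relators] by blast
  finally have "the_elem (formal_eval P f ` coset z) = formal_eval P f z" by simp
  then show ?thesis by (simp only: tensor_lift_def formal_eval_def[abs_def])
qed

lemma tensor_lift_pure:
  "x \<in> carrier M \<Longrightarrow> y \<in> carrier N \<Longrightarrow> tensor_lift P f (x \<star> y) = f x y"
  unfolding pure_coset
  by (simp add: tensor_lift_coset frag_of_free P.formal_eval_frag_of bilinear_closed[OF f])

lemma tensor_lift_add:
  assumes "s \<in> carrier T" "t \<in> carrier T"
  shows "tensor_lift P f (s \<oplus>\<^bsub>T\<^esub> t) = tensor_lift P f s \<oplus>\<^bsub>P\<^esub> tensor_lift P f t"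
proof -
  obtain z w where s: "s = coset z" "z \<in> carrier free_group" and t: "t = coset w" "w \<in> carrier free_group"
    using assms by (auto simp: carrier_T)
  have "f (fst q) (snd q) \<in> carrier P" if "q \<in> Poly_Mapping.keys z \<union> Poly_Mapping.keys w" for q
    using that s(2) t(2) by (intro bilinear_closed[OF f]) (auto simp: carrier_free)
  then have "formal_eval P f (z + w) = formal_eval P f z \<oplus>\<^bsub>P\<^esub> formal_eval P f w"
    by (rule P.formal_eval_add)
  then show ?thesis
    unfolding s(1) t(1) using s(2) t(2) by (simp add: add_coset tensor_lift_coset add_free)
qed

lemma tensor_lift_closed:
  assumes "t \<in> carrier T"
  shows "tensor_lift P f t \<in> carrier P"
  using assms
  by (induction t rule: tensor_induct)
    (simp_all add: tensor_lift_pure tensor_lift_add bilinear_closed[OF f])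

lemma tensor_lift_linear: "tensor_lift P f \<in> linear_maps K T P"
proof (rule linear_mapsI)
  interpret T: module K T by (rule module_T)
  show "tensor_lift P f (c \<odot>\<^bsub>T\<^esub> t) = c \<odot>\<^bsub>P\<^esub> tensor_lift P f t"
    if "c \<in> carrier K" "t \<in> carrier T" for c t
    using that(2)
  proof (induction t rule: tensor_induct)
    case (pure x y)
    then show ?case using that
      by (simp add: smult_pure_left tensor_lift_pure linear_smult[OF bilinear_left[OF f]])
  next
    case (add s t)
    then show ?case using that
      by (simp add: T.smult_r_distr tensor_lift_add P.smult_r_distr tensor_lift_closed)
  qed
qed (simp_all add: tensor_lift_closed tensor_lift_add)

end

lemma tensor_lift_cong:
  assumes "module K P" "f \<in> bilinear_maps K M N P"
    and "\<And>x y. x \<in> carrier M \<Longrightarrow> y \<in> carrier N \<Longrightarrow> f x y = g x y"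
    and "t \<in> carrier T"
  shows "tensor_lift P f t = tensor_lift P g t"
proof -
  have g: "g \<in> bilinear_maps K M N P"
    by (rule bilinear_cong[OF M.module_axioms N.module_axioms assms(2,3)])
  show ?thesis
    by (rule linear_eq_on_pure[OF tensor_lift_linear tensor_lift_linear])
      (simp_all add: assms g tensor_lift_pure)
qed

lemma linear_tensor_lift:
  assumes "module K P" "module K Q" "f \<in> bilinear_maps K M N P" "g \<in> linear_maps K P Q"
    and "t \<in> carrier T"
  shows "g (tensor_lift P f t) = tensor_lift Q (\<lambda>x y. g (f x y)) t"
  by (rule linear_eq_on_pure[OF linear_comp[OF assms(4) tensor_lift_linear] tensor_lift_linear])
    (simp_all add: assms bilinear_comp[OF assms(4,3)] tensor_lift_pure)

end


section \<open>Sweedler calculus\<close>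

context module_pair
begin

text \<open>If the bilinear map depends linearly on a parameter, so does its evaluation at a fixed tensor.
  This yields the multilinearity of nested Sweedler expressions.\<close>

lemma tensor_lift_parameter:
  assumes L: "module K L" and P: "module K P"
    and bil: "\<And>x. x \<in> carrier L \<Longrightarrow> f x \<in> bilinear_maps K M N P"
    and lin: "\<And>u v. \<lbrakk>u \<in> carrier M; v \<in> carrier N\<rbrakk> \<Longrightarrow> (\<lambda>x. f x u v) \<in> linear_maps K L P"
    and t: "t \<in> carrier T"
  shows "(\<lambda>x. tensor_lift P (f x) t) \<in> linear_maps K L P"
proof (rule linear_mapsI)
  interpret L: module K L by (rule L)
  interpret P: module K P by (rule P)
  show cl: "tensor_lift P (f x) t \<in> carrier P" if "x \<in> carrier L" for x
    by (rule tensor_lift_closed[OF P bil[OF that] t])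
  show "tensor_lift P (f (x \<oplus>\<^bsub>L\<^esub> y)) t = tensor_lift P (f x) t \<oplus>\<^bsub>P\<^esub> tensor_lift P (f y) t"
    if x: "x \<in> carrier L" and y: "y \<in> carrier L" for x y
  proof -
    have b: "f (x \<oplus>\<^bsub>L\<^esub> y) \<in> bilinear_maps K M N P" "f x \<in> bilinear_maps K M N P"
      "f y \<in> bilinear_maps K M N P"
      using bil x y by simp_all
    show ?thesis
      using t
    proof (induction t rule: tensor_induct)
      case (pure u v)
      then show ?case
        using linear_add[OF lin x y, of u v] by (simp add: tensor_lift_pure[OF P] b)
    next
      case (add s t)
      then show ?case
        by (simp add: tensor_lift_add[OF P] b tensor_lift_closed[OF P] P.add.m_ac)
    qed
  qed
  show "tensor_lift P (f (c \<odot>\<^bsub>L\<^esub> x)) t = c \<odot>\<^bsub>P\<^esub> tensor_lift P (f x) t"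
    if c: "c \<in> carrier K" and x: "x \<in> carrier L" for c x
  proof -
    have b: "f (c \<odot>\<^bsub>L\<^esub> x) \<in> bilinear_maps K M N P" "f x \<in> bilinear_maps K M N P"
      using bil x c by simp_all
    show ?thesis
      using t
    proof (induction t rule: tensor_induct)
      case (pure u v)
      then show ?case
        using linear_smult[OF lin c x, of u v] by (simp add: tensor_lift_pure[OF P] b)
    next
      case (add s t)
      then show ?case
        by (simp add: tensor_lift_add[OF P] b tensor_lift_closed[OF P] P.smult_r_distr c)
    qed
  qed
qed

end

lemma (in unital_algebra) module_algebra: "module K A"
  by (rule module_axioms)

lemma (in unital_algebra) linear_mult_right:
  assumes "f \<in> linear_maps K L A" "c \<in> carrier A"
  shows "(\<lambda>x. f x \<otimes>\<^bsub>A\<^esub> c) \<in> linear_maps K L A"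
  using assms by (auto simp: linear_maps_def Pi_iff smult_mult_left l_distr)

lemma (in unital_algebra) linear_mult_left:
  assumes "f \<in> linear_maps K L A" "c \<in> carrier A"
  shows "(\<lambda>x. c \<otimes>\<^bsub>A\<^esub> f x) \<in> linear_maps K L A"
  using assms by (auto simp: linear_maps_def Pi_iff smult_mult_right r_distr)

lemma (in module) linear_smult_const:
  assumes "f \<in> linear_maps R L M" "c \<in> carrier R"
  shows "(\<lambda>x. c \<odot>\<^bsub>M\<^esub> f x) \<in> linear_maps R L M"
  using assms by (auto simp: linear_maps_def Pi_iff smult_r_distr smult_assoc1[symmetric] m_comm)

lemma (in module) linear_scalar_smult:
  assumes "f \<in> linear_maps R L (scalar_module R)" "v \<in> carrier M"
  shows "(\<lambda>x. f x \<odot>\<^bsub>M\<^esub> v) \<in> linear_maps R L M"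
  using assms by (auto simp: linear_maps_def Pi_iff smult_l_distr smult_assoc1 scalar_module_def)

context hopf_algebra
begin

text \<open>
  Coassociativity, counit and antipode laws are given as identities between elements of \<open>H\<close> or
  of its tensor powers. Below each becomes a rewriting rule for \<open>sw P f h\<close>, the element \<open>f h\<^sub>1 h\<^sub>2\<close> of \<open>P\<close>,
  by applying to both sides the linear map induced by a multilinear \<open>f\<close>.
\<close>

interpretation HH: module_pair K H H
  by (intro module_pair.intro module_algebra)

abbreviation sw where "sw \<equiv> sweedler H"
abbreviation bil where "bil \<equiv> bilinear_maps K H H"
abbreviation S where "S \<equiv> antipode H"
abbreviation \<epsilon> where "\<epsilon> \<equiv> counit H"

lemma comul_closed: "h \<in> carrier H \<Longrightarrow> comul H h \<in> carrier HH.T"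
  by (rule linear_closed[OF comul_linear])

lemma S_closed [simp]: "h \<in> carrier H \<Longrightarrow> S h \<in> carrier H"
  by (rule linear_closed[OF antipode_linear])

lemma counit_closed [simp]: "h \<in> carrier H \<Longrightarrow> \<epsilon> h \<in> carrier K"
  using linear_closed[OF counit_linear] by (simp add: scalar_module_def)

lemma sw_closed: "\<lbrakk>h \<in> carrier H; module K P; f \<in> bil P\<rbrakk> \<Longrightarrow> sw P f h \<in> carrier P"
  unfolding sweedler_def by (intro HH.tensor_lift_closed comul_closed)

lemma sw_cong:
  assumes "h \<in> carrier H" "module K P" "f \<in> bil P"
    and "\<And>x y. \<lbrakk>x \<in> carrier H; y \<in> carrier H\<rbrakk> \<Longrightarrow> f x y = g x y"
  shows "sw P f h = sw P g h"
  unfolding sweedler_def using assms by (intro HH.tensor_lift_cong comul_closed)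

lemma linear_sw:
  assumes "h \<in> carrier H" "module K P" "module K Q" "f \<in> bil P" "g \<in> linear_maps K P Q"
  shows "g (sw P f h) = sw Q (\<lambda>x y. g (f x y)) h"
  unfolding sweedler_def using assms by (intro HH.linear_tensor_lift comul_closed)

lemma linear_sw_argument:
  "\<lbrakk>module K P; f \<in> bil P; g \<in> linear_maps K L H\<rbrakk> \<Longrightarrow> (\<lambda>x. sw P f (g x)) \<in> linear_maps K L P"
  unfolding sweedler_def
  by (rule linear_comp[OF HH.tensor_lift_linear linear_comp[OF comul_linear]])

lemma linear_sw_parameter:
  assumes "module K L" "module K P" "h \<in> carrier H"
    and "\<And>x. x \<in> carrier L \<Longrightarrow> (\<lambda>u v. f x u v) \<in> bil P"
    and "\<And>u v. \<lbrakk>u \<in> carrier H; v \<in> carrier H\<rbrakk> \<Longrightarrow> (\<lambda>x. f x u v) \<in> linear_maps K L P"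
  shows "(\<lambda>x. sw P (\<lambda>u v. f x u v) h) \<in> linear_maps K L P"
  unfolding sweedler_def
  using assms by (intro HH.tensor_lift_parameter comul_closed)

text \<open>Sweedler sums over different elements are independent. Both sides are linear in the
  comultiplication of \<open>h\<close>, so it may be replaced by a pure tensor.\<close>

lemma sw_swap:
  assumes P: "module K P" and h: "h \<in> carrier H" and k: "k \<in> carrier H"
    and 1: "\<And>u v. \<lbrakk>u \<in> carrier H; v \<in> carrier H\<rbrakk> \<Longrightarrow> (\<lambda>x y. f x y u v) \<in> bil P"
    and 2: "\<And>x y. \<lbrakk>x \<in> carrier H; y \<in> carrier H\<rbrakk> \<Longrightarrow> (\<lambda>u v. f x y u v) \<in> bil P"
  shows "sw P (\<lambda>x y. sw P (\<lambda>u v. f x y u v) k) h = sw P (\<lambda>u v. sw P (\<lambda>x y. f x y u v) h) k"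
proof -
  have b: "(\<lambda>x y. sw P (\<lambda>u v. f x y u v) k) \<in> bil P"
    by (intro bilinear_mapsI linear_sw_parameter module_algebra P k 2 bilinear_left[OF 1] bilinear_right[OF 1])
  have c: "(\<lambda>u v. tensor_lift P (\<lambda>x y. f x y u v) t) \<in> bil P" if "t \<in> carrier HH.T" for t
    by (intro bilinear_mapsI HH.tensor_lift_parameter module_algebra P that 1 bilinear_left[OF 2] bilinear_right[OF 2])
  have d: "(\<lambda>t. sw P (\<lambda>u v. tensor_lift P (\<lambda>x y. f x y u v) t) k) \<in> linear_maps K HH.T P"
    by (rule linear_sw_parameter[OF HH.module_T P k c HH.tensor_lift_linear[OF P 1]])
  have "tensor_lift P (\<lambda>x y. sw P (\<lambda>u v. f x y u v) k) t
      = sw P (\<lambda>u v. tensor_lift P (\<lambda>x y. f x y u v) t) k" if t: "t \<in> carrier HH.T" for t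
  proof (rule HH.linear_eq_on_pure[OF HH.tensor_lift_linear[OF P b] d _ t])
    fix x y assume xy: "x \<in> carrier H" "y \<in> carrier H"
    have "sw P (\<lambda>u v. f x y u v) k
        = sw P (\<lambda>u v. tensor_lift P (\<lambda>x y. f x y u v) (pure_tensor K H H x y)) k"
      by (rule sw_cong[OF k P 2[OF xy]]) (simp add: HH.tensor_lift_pure[OF P 1] xy)
    then show "tensor_lift P (\<lambda>x y. sw P (\<lambda>u v. f x y u v) k) (pure_tensor K H H x y)
        = sw P (\<lambda>u v. tensor_lift P (\<lambda>x y. f x y u v) (pure_tensor K H H x y)) k"
      by (simp add: HH.tensor_lift_pure[OF P b] xy)
  qed
  from this[OF comul_closed[OF h]] show ?thesis by (simp add: sweedler_def)
qed

text \<open>Three Sweedler components can be grouped either way: the map \<open>u \<otimes> (v \<otimes> y) \<mapsto> f u v y\<close> is applied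
  to the coassociativity law.\<close>

lemma sw_coassoc:
  assumes P: "module K P" and h: "h \<in> carrier H"
    and 1: "\<And>y. y \<in> carrier H \<Longrightarrow> (\<lambda>u v. f u v y) \<in> bil P"
    and 2: "\<And>u. u \<in> carrier H \<Longrightarrow> (\<lambda>v y. f u v y) \<in> bil P"
  shows "sw P (\<lambda>x y. sw P (\<lambda>u v. f u v y) x) h = sw P (\<lambda>x y. sw P (\<lambda>u v. f x u v) y) h"
proof -
  interpret H3: module_pair K H HH.T
    by (intro module_pair.intro module_algebra HH.module_T)
  note [intro] = bilinear_left[OF 1] bilinear_right[OF 1] bilinear_left[OF 2] bilinear_right[OF 2]
  let ?\<Phi> = "tensor_lift P (\<lambda>u w. tensor_lift P (\<lambda>v y. f u v y) w)"
  have b: "(\<lambda>u w. tensor_lift P (\<lambda>v y. f u v y) w) \<in> bilinear_maps K H HH.T P"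
    by (intro bilinear_mapsI HH.tensor_lift_linear HH.tensor_lift_parameter module_algebra P 2)
      (use bilinear_left[OF 1] in auto)
  note lin = H3.tensor_lift_linear[OF P b]
  have pl: "(\<lambda>u. pure_tensor K H H u v) \<in> linear_maps K H HH.T"
    and pr: "(\<lambda>u. pure_tensor K H H v u) \<in> linear_maps K H HH.T" if "v \<in> carrier H" for v
    using bilinear_left[OF HH.pure_bilinear that] bilinear_right[OF HH.pure_bilinear that] by auto
  have pl3: "(\<lambda>u. pure_tensor K H HH.T u v) \<in> linear_maps K H H3.T" if "v \<in> carrier HH.T" for v
    using bilinear_left[OF H3.pure_bilinear that] by auto
  have pr3: "(\<lambda>u. pure_tensor K H HH.T v u) \<in> linear_maps K HH.T H3.T" if "v \<in> carrier H" for v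
    using bilinear_right[OF H3.pure_bilinear that] by auto
  have b1: "(\<lambda>u v. pure_tensor K H HH.T u (pure_tensor K H H v y)) \<in> bil H3.T" if "y \<in> carrier H" for y
    by (intro bilinear_mapsI pl3 linear_comp[OF pr3] pl that HH.pure_closed)
  have b2: "(\<lambda>x y. sw H3.T (\<lambda>u v. pure_tensor K H HH.T u (pure_tensor K H H v y)) x) \<in> bil H3.T"
    by (intro bilinear_mapsI linear_sw_parameter linear_sw_argument linear_id b1 module_algebra
        H3.module_T linear_comp[OF pr3] pr)
  have b3: "(\<lambda>x y. pure_tensor K H HH.T x (comul H y)) \<in> bil H3.T"
    by (intro bilinear_mapsI pl3 linear_comp[OF pr3] comul_closed comul_linear)
  have "?\<Phi> (sw H3.T (\<lambda>x y. sw H3.T (\<lambda>u v. pure_tensor K H HH.T u (pure_tensor K H H v y)) x) h)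
      = sw P (\<lambda>x y. ?\<Phi> (sw H3.T (\<lambda>u v. pure_tensor K H HH.T u (pure_tensor K H H v y)) x)) h"
    by (rule linear_sw[OF h H3.module_T P b2 lin])
  also have "\<dots> = sw P (\<lambda>x y. sw P (\<lambda>u v. f u v y) x) h"
  proof (rule sw_cong[OF h P bilinear_comp[OF lin b2]])
    fix x y assume xy: "x \<in> carrier H" "y \<in> carrier H"
    have "?\<Phi> (sw H3.T (\<lambda>u v. pure_tensor K H HH.T u (pure_tensor K H H v y)) x)
      = sw P (\<lambda>u v. ?\<Phi> (pure_tensor K H HH.T u (pure_tensor K H H v y))) x"
      by (rule linear_sw[OF xy(1) H3.module_T P b1[OF xy(2)] lin])
    also have "\<dots> = sw P (\<lambda>u v. f u v y) x"
      by (rule sw_cong[OF xy(1) P bilinear_comp[OF lin b1[OF xy(2)]]])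
        (simp add: H3.tensor_lift_pure[OF P b] HH.tensor_lift_pure[OF P 2] HH.pure_closed xy)
    finally show "?\<Phi> (sw H3.T (\<lambda>u v. pure_tensor K H HH.T u (pure_tensor K H H v y)) x)
      = sw P (\<lambda>u v. f u v y) x" .
  qed
  finally have l: "?\<Phi> (sw H3.T (\<lambda>x y. sw H3.T (\<lambda>u v. pure_tensor K H HH.T u (pure_tensor K H H v y)) x) h)
    = sw P (\<lambda>x y. sw P (\<lambda>u v. f u v y) x) h" .
  have "?\<Phi> (sw H3.T (\<lambda>x y. pure_tensor K H HH.T x (comul H y)) h)
      = sw P (\<lambda>x y. ?\<Phi> (pure_tensor K H HH.T x (comul H y))) h"
    by (rule linear_sw[OF h H3.module_T P b3 lin])
  also have "\<dots> = sw P (\<lambda>x y. sw P (\<lambda>u v. f x u v) y) h"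
    by (rule sw_cong[OF h P bilinear_comp[OF lin b3]])
      (simp add: H3.tensor_lift_pure[OF P b] comul_closed sweedler_def)
  finally show ?thesis using l coassoc[OF h] by simp
qed

lemma sw_counit_left:
  assumes P: "module K P" and h: "h \<in> carrier H" and g: "g \<in> linear_maps K H P"
  shows "sw P (\<lambda>x y. \<epsilon> x \<odot>\<^bsub>P\<^esub> g y) h = g h"
proof -
  have b: "(\<lambda>x y. \<epsilon> x \<odot>\<^bsub>H\<^esub> y) \<in> bil H"
    by (intro bilinear_mapsI linear_scalar_smult linear_smult_const linear_id counit_linear) auto
  have "g h = g (sw H (\<lambda>x y. \<epsilon> x \<odot>\<^bsub>H\<^esub> y) h)" by (simp add: counit_left h)
  also have "\<dots> = sw P (\<lambda>x y. g (\<epsilon> x \<odot>\<^bsub>H\<^esub> y)) h"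
    by (rule linear_sw[OF h module_algebra P b g])
  also have "\<dots> = sw P (\<lambda>x y. \<epsilon> x \<odot>\<^bsub>P\<^esub> g y) h"
    by (rule sw_cong[OF h P bilinear_comp[OF g b]]) (simp add: linear_smult[OF g])
  finally show ?thesis by simp
qed

lemma sw_counit_right:
  assumes P: "module K P" and h: "h \<in> carrier H" and g: "g \<in> linear_maps K H P"
  shows "sw P (\<lambda>x y. \<epsilon> y \<odot>\<^bsub>P\<^esub> g x) h = g h"
proof -
  have b: "(\<lambda>x y. \<epsilon> y \<odot>\<^bsub>H\<^esub> x) \<in> bil H"
    by (intro bilinear_mapsI linear_scalar_smult linear_smult_const linear_id counit_linear) auto
  have "g h = g (sw H (\<lambda>x y. \<epsilon> y \<odot>\<^bsub>H\<^esub> x) h)" by (simp add: counit_right h)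
  also have "\<dots> = sw P (\<lambda>x y. g (\<epsilon> y \<odot>\<^bsub>H\<^esub> x)) h"
    by (rule linear_sw[OF h module_algebra P b g])
  also have "\<dots> = sw P (\<lambda>x y. \<epsilon> y \<odot>\<^bsub>P\<^esub> g x) h"
    by (rule sw_cong[OF h P bilinear_comp[OF g b]]) (simp add: linear_smult[OF g])
  finally show ?thesis by simp
qed

lemma sw_antipode_left:
  assumes P: "module K P" and h: "h \<in> carrier H" and g: "g \<in> linear_maps K H P"
  shows "sw P (\<lambda>x y. g (S x \<otimes>\<^bsub>H\<^esub> y)) h = \<epsilon> h \<odot>\<^bsub>P\<^esub> g \<one>\<^bsub>H\<^esub>"
proof -
  have b: "(\<lambda>x y. S x \<otimes>\<^bsub>H\<^esub> y) \<in> bil H"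
    by (intro bilinear_mapsI linear_mult_left linear_mult_right antipode_linear linear_id S_closed)
  show ?thesis
    using linear_sw[OF h module_algebra P b g] antipode_left[OF h]
    by (simp add: linear_smult[OF g] h)
qed

lemma sw_antipode_right:
  assumes P: "module K P" and h: "h \<in> carrier H" and g: "g \<in> linear_maps K H P"
  shows "sw P (\<lambda>x y. g (x \<otimes>\<^bsub>H\<^esub> S y)) h = \<epsilon> h \<odot>\<^bsub>P\<^esub> g \<one>\<^bsub>H\<^esub>"
proof -
  have b: "(\<lambda>x y. x \<otimes>\<^bsub>H\<^esub> S y) \<in> bil H"
    by (intro bilinear_mapsI linear_mult_left linear_mult_right antipode_linear linear_id S_closed)
  show ?thesis
    using linear_sw[OF h module_algebra P b g] antipode_right[OF h]
    by (simp add: linear_smult[OF g] h)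
qed

lemma sw_one:
  assumes P: "module K P" and f: "f \<in> bil P"
  shows "sw P f \<one>\<^bsub>H\<^esub> = f \<one>\<^bsub>H\<^esub> \<one>\<^bsub>H\<^esub>"
  by (simp add: sweedler_def comul_one HH.tensor_lift_pure[OF P f])

text \<open>The left side is the Sweedler sum for the co-opposite comultiplication.\<close>

lemma tensor_lift_flip_comul:
  assumes P: "module K P" and h: "h \<in> carrier H" and f: "f \<in> bil P"
  shows "tensor_lift P f (sw HH.T (\<lambda>x y. pure_tensor K H H y x) h) = sw P (\<lambda>x y. f y x) h"
proof -
  have b: "(\<lambda>x y. pure_tensor K H H y x) \<in> bil HH.T"
    by (intro bilinear_mapsI bilinear_left[OF HH.pure_bilinear] bilinear_right[OF HH.pure_bilinear])
  note l = HH.tensor_lift_linear[OF P f]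
  have "tensor_lift P f (sw HH.T (\<lambda>x y. pure_tensor K H H y x) h)
      = sw P (\<lambda>x y. tensor_lift P f (pure_tensor K H H y x)) h"
    by (rule linear_sw[OF h HH.module_T P b l])
  also have "\<dots> = sw P (\<lambda>x y. f y x) h"
    by (rule sw_cong[OF h P bilinear_comp[OF l b]]) (simp add: HH.tensor_lift_pure[OF P f])
  finally show ?thesis .
qed

lemma sw_mult:
  assumes P: "module K P" and h: "h \<in> carrier H" and k: "k \<in> carrier H" and f: "f \<in> bil P"
  shows "sw P f (h \<otimes>\<^bsub>H\<^esub> k) = sw P (\<lambda>x y. sw P (\<lambda>u v. f (x \<otimes>\<^bsub>H\<^esub> u) (y \<otimes>\<^bsub>H\<^esub> v)) k) h"
proof -
  let ?p = "\<lambda>x y u v. pure_tensor K H H (x \<otimes>\<^bsub>H\<^esub> u) (y \<otimes>\<^bsub>H\<^esub> v)"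
  note pl = bilinear_left[OF HH.pure_bilinear] and pr = bilinear_right[OF HH.pure_bilinear]
  have b1: "(\<lambda>u v. ?p x y u v) \<in> bil HH.T" if "x \<in> carrier H" "y \<in> carrier H" for x y
    by (intro bilinear_mapsI linear_comp[OF pl] linear_comp[OF pr] linear_mult_left linear_id
        m_closed that)
  have b1': "(\<lambda>x y. ?p x y u v) \<in> bil HH.T" if "u \<in> carrier H" "v \<in> carrier H" for u v
    by (intro bilinear_mapsI linear_comp[OF pl] linear_comp[OF pr] linear_mult_right linear_id
        m_closed that)
  have b2: "(\<lambda>x y. sw HH.T (\<lambda>u v. ?p x y u v) k) \<in> bil HH.T"
    by (intro bilinear_mapsI linear_sw_parameter module_algebra HH.module_T k b1
        bilinear_left[OF b1'] bilinear_right[OF b1'])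
  note l = HH.tensor_lift_linear[OF P f]
  have "sw P f (h \<otimes>\<^bsub>H\<^esub> k) = tensor_lift P f (sw HH.T (\<lambda>x y. sw HH.T (\<lambda>u v. ?p x y u v) k) h)"
    unfolding sweedler_def[of H P] comul_mult[OF h k] ..
  also have "\<dots> = sw P (\<lambda>x y. tensor_lift P f (sw HH.T (\<lambda>u v. ?p x y u v) k)) h"
    by (rule linear_sw[OF h HH.module_T P b2 l])
  also have "\<dots> = sw P (\<lambda>x y. sw P (\<lambda>u v. f (x \<otimes>\<^bsub>H\<^esub> u) (y \<otimes>\<^bsub>H\<^esub> v)) k) h"
  proof (rule sw_cong[OF h P bilinear_comp[OF l b2]])
    fix x y assume xy: "x \<in> carrier H" "y \<in> carrier H"
    have "tensor_lift P f (sw HH.T (\<lambda>u v. ?p x y u v) k) = sw P (\<lambda>u v. tensor_lift P f (?p x y u v)) k"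
      by (rule linear_sw[OF k HH.module_T P b1[OF xy] l])
    also have "\<dots> = sw P (\<lambda>u v. f (x \<otimes>\<^bsub>H\<^esub> u) (y \<otimes>\<^bsub>H\<^esub> v)) k"
      by (rule sw_cong[OF k P bilinear_comp[OF l b1[OF xy]]]) (simp add: HH.tensor_lift_pure[OF P f] xy)
    finally show "tensor_lift P f (sw HH.T (\<lambda>u v. ?p x y u v) k)
      = sw P (\<lambda>u v. f (x \<otimes>\<^bsub>H\<^esub> u) (y \<otimes>\<^bsub>H\<^esub> v)) k" .
  qed
  finally show ?thesis .
qed

lemma sw_mult_left:
  assumes "unital_algebra K A" "c \<in> carrier A" "f \<in> bil A" "h \<in> carrier H"
  shows "c \<otimes>\<^bsub>A\<^esub> sw A f h = sw A (\<lambda>x y. c \<otimes>\<^bsub>A\<^esub> f x y) h"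
proof -
  interpret A: unital_algebra K A by fact
  show ?thesis
    by (rule linear_sw[of _ _ _ _ "\<lambda>x. c \<otimes>\<^bsub>A\<^esub> x"])
      (simp_all add: assms A.module_algebra A.linear_mult_left linear_id)
qed

lemma sw_mult_right:
  assumes "unital_algebra K A" "c \<in> carrier A" "f \<in> bil A" "h \<in> carrier H"
  shows "sw A f h \<otimes>\<^bsub>A\<^esub> c = sw A (\<lambda>x y. f x y \<otimes>\<^bsub>A\<^esub> c) h"
proof -
  interpret A: unital_algebra K A by fact
  show ?thesis
    by (rule linear_sw[of _ _ _ _ "\<lambda>x. x \<otimes>\<^bsub>A\<^esub> c"])
      (simp_all add: assms A.module_algebra A.linear_mult_right linear_id)
qed

text \<open>Every step of a Sweedler computation has the side condition that the expressions involved are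
  multilinear. These rules decompose that condition along the term; the later collections of rules
  add the maps at hand, and the step then has the form of one law applied by \<open>rule\<close>, followed by
  the decomposition of its side conditions.\<close>

lemmas linear_rules = bilinear_mapsI linear_mult_right linear_mult_left linear_sw_argument
  linear_sw_parameter linear_comp[OF antipode_linear] linear_id sw_closed


section \<open>The antipode and its inverse\<close>

text \<open>Apply the counit to \<open>S h\<^sub>1 h\<^sub>2 = \<epsilon>(h)\<close>. The scalar field is embedded into \<open>H\<close> through
  multiples of the unit, so that the rules for maps into an algebra apply.\<close>

lemma counit_antipode:
  assumes h: "h \<in> carrier H"
  shows "\<epsilon> (S h) = \<epsilon> h"
proof -
  note mod = module_algebra
  have g: "(\<lambda>x. \<epsilon> x \<odot>\<^bsub>H\<^esub> \<one>\<^bsub>H\<^esub>) \<in> linear_maps K H H"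
    by (intro linear_scalar_smult counit_linear) simp
  have gS: "(\<lambda>x. \<epsilon> (S x) \<odot>\<^bsub>H\<^esub> \<one>\<^bsub>H\<^esub>) \<in> linear_maps K H H"
    by (rule linear_comp[OF g antipode_linear])
  have b: "(\<lambda>x y. \<epsilon> (S x \<otimes>\<^bsub>H\<^esub> y) \<odot>\<^bsub>H\<^esub> \<one>\<^bsub>H\<^esub>) \<in> bil H"
    by (intro bilinear_mapsI linear_comp[OF g] linear_rules; simp)
  have e: "\<epsilon> (S x \<otimes>\<^bsub>H\<^esub> y) \<odot>\<^bsub>H\<^esub> \<one>\<^bsub>H\<^esub> = \<epsilon> y \<odot>\<^bsub>H\<^esub> (\<epsilon> (S x) \<odot>\<^bsub>H\<^esub> \<one>\<^bsub>H\<^esub>)"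
    if "x \<in> carrier H" "y \<in> carrier H" for x y
    using that by (simp add: counit_mult smult_assoc1[symmetric] K.m_comm)
  have "\<epsilon> h \<odot>\<^bsub>H\<^esub> \<one>\<^bsub>H\<^esub> = sw H (\<lambda>x y. \<epsilon> (S x \<otimes>\<^bsub>H\<^esub> y) \<odot>\<^bsub>H\<^esub> \<one>\<^bsub>H\<^esub>) h"
    using sw_antipode_left[OF mod h g] by (simp add: counit_one)
  also have "\<dots> = sw H (\<lambda>x y. \<epsilon> y \<odot>\<^bsub>H\<^esub> (\<epsilon> (S x) \<odot>\<^bsub>H\<^esub> \<one>\<^bsub>H\<^esub>)) h"
    by (rule sw_cong[OF h mod b e])
  also have "\<dots> = \<epsilon> (S h) \<odot>\<^bsub>H\<^esub> \<one>\<^bsub>H\<^esub>" by (rule sw_counit_right[OF mod h gS])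
  finally have "\<epsilon> (\<epsilon> h \<odot>\<^bsub>H\<^esub> \<one>\<^bsub>H\<^esub>) = \<epsilon> (\<epsilon> (S h) \<odot>\<^bsub>H\<^esub> \<one>\<^bsub>H\<^esub>)" by simp
  moreover have "\<epsilon> (c \<odot>\<^bsub>H\<^esub> \<one>\<^bsub>H\<^esub>) = c" if "c \<in> carrier K" for c
    using linear_smult[OF counit_linear that, of "\<one>\<^bsub>H\<^esub>"] that
    by (simp add: scalar_module_def counit_one)
  ultimately show ?thesis using h by simp
qed

text \<open>The antipode reverses the comultiplication. In the convolution algebra of maps from \<open>H\<close> to
  \<open>H \<otimes> H\<close>, both \<open>h \<mapsto> \<Delta>(S h)\<close> and \<open>h \<mapsto> S h\<^sub>2 \<otimes> S h\<^sub>1\<close> are inverse to \<open>\<Delta>\<close>: the first on the left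
  because \<open>\<Delta>\<close> is multiplicative, the second on the right. A left and a right inverse agree, since
  both equal the convolution product of the two with \<open>\<Delta>\<close> in between. Here this product is
  evaluated under \<open>f\<close>, as \<open>?M\<close> below.\<close>

lemma sw_antipode:
  assumes P: "module K P" and h: "h \<in> carrier H" and f: "f \<in> bil P"
  shows "sw P f (S h) = sw P (\<lambda>x y. f (S y) (S x)) h"
proof -
  interpret P: module K P by (rule P)
  note lin = linear_rules linear_comp[OF bilinear_left[OF f]] linear_comp[OF bilinear_right[OF f]]
  \<comment> \<open>\<open>p \<otimes> q\<close> runs over \<open>\<Delta>(S h\<^sub>1)\<close>, \<open>r \<otimes> s\<close> over \<open>\<Delta>(h\<^sub>2)\<close>, and \<open>c \<otimes> d\<close> over \<open>\<Delta>(h\<^sub>3)\<close>\<close>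
  let ?M = "sw P (\<lambda>x y. sw P (\<lambda>u v. sw P (\<lambda>p q. sw P (\<lambda>r s. sw P (\<lambda>c d.
      f (p \<otimes>\<^bsub>H\<^esub> r \<otimes>\<^bsub>H\<^esub> S d) (q \<otimes>\<^bsub>H\<^esub> (s \<otimes>\<^bsub>H\<^esub> S c))) v) u) (S x)) y) h"
  let ?W = "\<lambda>z v. sw P (\<lambda>p q. sw P (\<lambda>c d. f (p \<otimes>\<^bsub>H\<^esub> S d) (q \<otimes>\<^bsub>H\<^esub> S c)) v) z"
  have W: "?W \<in> bil P"
    by (intro lin; simp add: P module_algebra)
  \<comment> \<open>the product of the first two factors is \<open>\<Delta>(S h\<^sub>1 h\<^sub>2)\<close>\<close>
  have S1: "sw P (\<lambda>p q. sw P (\<lambda>r s. sw P (\<lambda>c d.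
      f (p \<otimes>\<^bsub>H\<^esub> r \<otimes>\<^bsub>H\<^esub> S d) (q \<otimes>\<^bsub>H\<^esub> (s \<otimes>\<^bsub>H\<^esub> S c))) v) u) (S x) = ?W (S x \<otimes>\<^bsub>H\<^esub> u) v"
    if "x \<in> carrier H" "u \<in> carrier H" "v \<in> carrier H" for x u v
  proof -
    have "?W (S x \<otimes>\<^bsub>H\<^esub> u) v = sw P (\<lambda>p q. sw P (\<lambda>r s. sw P (\<lambda>c d.
      f (p \<otimes>\<^bsub>H\<^esub> r \<otimes>\<^bsub>H\<^esub> S d) (q \<otimes>\<^bsub>H\<^esub> s \<otimes>\<^bsub>H\<^esub> S c)) v) u) (S x)"
      by (rule sw_mult; (intro lin)?; simp add: P module_algebra that)
    also have "\<dots> = sw P (\<lambda>p q. sw P (\<lambda>r s. sw P (\<lambda>c d.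
      f (p \<otimes>\<^bsub>H\<^esub> r \<otimes>\<^bsub>H\<^esub> S d) (q \<otimes>\<^bsub>H\<^esub> (s \<otimes>\<^bsub>H\<^esub> S c))) v) u) (S x)"
      by (intro sw_cong lin; simp add: P module_algebra that m_assoc)
    finally show ?thesis by simp
  qed
  note [simp] = P module_algebra
  have "?M = sw P (\<lambda>x y. sw P (\<lambda>u v. ?W (S x \<otimes>\<^bsub>H\<^esub> u) v) y) h"
    by (intro sw_cong lin; (rule S1)?; simp add: h)
  also have "\<dots> = sw P (\<lambda>t v. sw P (\<lambda>x u. ?W (S x \<otimes>\<^bsub>H\<^esub> u) v) t) h"
    by (rule sw_coassoc[symmetric]; (intro lin)?; simp add: h)
  also have "\<dots> = sw P (\<lambda>t v. \<epsilon> t \<odot>\<^bsub>P\<^esub> ?W \<one>\<^bsub>H\<^esub> v) h"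
    by (rule sw_cong; (intro lin)?; (rule sw_antipode_left; (intro lin)?)?; simp add: h)
  also have "\<dots> = ?W \<one>\<^bsub>H\<^esub> h"
    by (rule sw_counit_left; (intro lin)?; simp add: h)
  also have "\<dots> = sw P (\<lambda>c d. f (\<one>\<^bsub>H\<^esub> \<otimes>\<^bsub>H\<^esub> S d) (\<one>\<^bsub>H\<^esub> \<otimes>\<^bsub>H\<^esub> S c)) h"
    by (rule sw_one; (intro lin)?; simp add: h)
  also have "\<dots> = sw P (\<lambda>x y. f (S y) (S x)) h"
    by (intro sw_cong lin; simp add: h)
  finally have right: "?M = sw P (\<lambda>x y. f (S y) (S x)) h" .
  \<comment> \<open>the product of the last two factors is \<open>h\<^sub>1 S h\<^sub>4 \<otimes> h\<^sub>2 S h\<^sub>3\<close>, which collapses from the inside\<close>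
  have N: "sw P (\<lambda>u v. sw P (\<lambda>r s. sw P (\<lambda>c d.
      f (p \<otimes>\<^bsub>H\<^esub> r \<otimes>\<^bsub>H\<^esub> S d) (q \<otimes>\<^bsub>H\<^esub> (s \<otimes>\<^bsub>H\<^esub> S c))) v) u) y = \<epsilon> y \<odot>\<^bsub>P\<^esub> f p q"
    (is "?N = _") if [simp]: "p \<in> carrier H" "q \<in> carrier H" "y \<in> carrier H" for p q y
  proof -
    have in1: "sw P (\<lambda>s v. sw P (\<lambda>c d. f (p \<otimes>\<^bsub>H\<^esub> r \<otimes>\<^bsub>H\<^esub> S d) (q \<otimes>\<^bsub>H\<^esub> (s \<otimes>\<^bsub>H\<^esub> S c))) v) w
      = f (p \<otimes>\<^bsub>H\<^esub> r \<otimes>\<^bsub>H\<^esub> S w) q" (is "?L = _")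
      if [simp]: "r \<in> carrier H" "w \<in> carrier H" for r w
    proof -
      have "?L = sw P (\<lambda>e d. sw P (\<lambda>s c. f (p \<otimes>\<^bsub>H\<^esub> r \<otimes>\<^bsub>H\<^esub> S d) (q \<otimes>\<^bsub>H\<^esub> (s \<otimes>\<^bsub>H\<^esub> S c))) e) w"
        by (rule sw_coassoc[symmetric]; (intro lin)?; simp)
      also have "\<dots> = sw P (\<lambda>e d. \<epsilon> e \<odot>\<^bsub>P\<^esub> f (p \<otimes>\<^bsub>H\<^esub> r \<otimes>\<^bsub>H\<^esub> S d) (q \<otimes>\<^bsub>H\<^esub> \<one>\<^bsub>H\<^esub>)) w"
        by (rule sw_cong; (intro lin)?; (rule sw_antipode_right; (intro lin)?)?; simp)
      also have "\<dots> = f (p \<otimes>\<^bsub>H\<^esub> r \<otimes>\<^bsub>H\<^esub> S w) (q \<otimes>\<^bsub>H\<^esub> \<one>\<^bsub>H\<^esub>)"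
        by (rule sw_counit_left; (intro lin)?; simp)
      finally show ?thesis by simp
    qed
    have "?N = sw P (\<lambda>r w. sw P (\<lambda>s v. sw P (\<lambda>c d.
      f (p \<otimes>\<^bsub>H\<^esub> r \<otimes>\<^bsub>H\<^esub> S d) (q \<otimes>\<^bsub>H\<^esub> (s \<otimes>\<^bsub>H\<^esub> S c))) v) w) y"
      by (rule sw_coassoc; (intro lin)?; simp)
    also have "\<dots> = sw P (\<lambda>r w. f (p \<otimes>\<^bsub>H\<^esub> (r \<otimes>\<^bsub>H\<^esub> S w)) q) y"
      by (rule sw_cong; (intro lin)?; simp add: in1 m_assoc[symmetric])
    also have "\<dots> = \<epsilon> y \<odot>\<^bsub>P\<^esub> f (p \<otimes>\<^bsub>H\<^esub> \<one>\<^bsub>H\<^esub>) q"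
      by (rule sw_antipode_right; (intro lin)?; simp)
    finally show ?thesis by simp
  qed
  have inner: "sw P (\<lambda>u v. sw P (\<lambda>p q. sw P (\<lambda>r s. sw P (\<lambda>c d.
      f (p \<otimes>\<^bsub>H\<^esub> r \<otimes>\<^bsub>H\<^esub> S d) (q \<otimes>\<^bsub>H\<^esub> (s \<otimes>\<^bsub>H\<^esub> S c))) v) u) (S x)) y = \<epsilon> y \<odot>\<^bsub>P\<^esub> sw P f (S x)"
    (is "?L = _") if [simp]: "x \<in> carrier H" "y \<in> carrier H" for x y
  proof -
    have "?L = sw P (\<lambda>p q. sw P (\<lambda>u v. sw P (\<lambda>r s. sw P (\<lambda>c d.
      f (p \<otimes>\<^bsub>H\<^esub> r \<otimes>\<^bsub>H\<^esub> S d) (q \<otimes>\<^bsub>H\<^esub> (s \<otimes>\<^bsub>H\<^esub> S c))) v) u) y) (S x)"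
      by (rule sw_swap; (intro lin)?; simp)
    also have "\<dots> = sw P (\<lambda>p q. \<epsilon> y \<odot>\<^bsub>P\<^esub> f p q) (S x)"
      by (rule sw_cong; (intro lin)?; (rule N)?; simp)
    also have "\<dots> = \<epsilon> y \<odot>\<^bsub>P\<^esub> sw P f (S x)"
      by (rule linear_sw[symmetric]; (intro P.linear_smult_const linear_id)?; simp add: f)
    finally show ?thesis .
  qed
  have "?M = sw P (\<lambda>x y. \<epsilon> y \<odot>\<^bsub>P\<^esub> sw P f (S x)) h"
    by (rule sw_cong; (intro lin)?; (rule inner)?; simp add: h)
  also have "\<dots> = sw P f (S h)"
    by (rule sw_counit_right; (intro lin f)?; simp add: h)
  finally show ?thesis using right by simp
qed

section \<open>Opposite and co-opposite structures\<close>

lemma sweedler_opcop: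
  assumes "module K P" "h \<in> carrier H" "f \<in> bil P"
  shows "sweedler (hopf_opcop K H) P f h = sw P (\<lambda>x y. f y x) h"
  unfolding sweedler_def[of "hopf_opcop K H"]
  using tensor_lift_flip_comul[OF assms] by (simp add: hopf_opcop_def)

lemma opcop_sel [simp]:
  "carrier (hopf_opcop K H) = carrier H" "\<one>\<^bsub>hopf_opcop K H\<^esub> = \<one>\<^bsub>H\<^esub>"
  "x \<otimes>\<^bsub>hopf_opcop K H\<^esub> y = y \<otimes>\<^bsub>H\<^esub> x" "antipode (hopf_opcop K H) = antipode H"
  "linear_maps K (hopf_opcop K H) B = linear_maps K H B"
  by (simp_all add: hopf_opcop_def linear_maps_def)

text \<open>Taking the opposite changes neither the comultiplication nor the underlying vector space.\<close>

lemma sweedler_op: "sweedler (hopf_op H) = sw"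
  by (intro ext) (simp add: sweedler_def hopf_op_def)

lemma op_sel [simp]:
  "carrier (hopf_op H) = carrier H" "\<one>\<^bsub>hopf_op H\<^esub> = \<one>\<^bsub>H\<^esub>"
  "x \<otimes>\<^bsub>hopf_op H\<^esub> y = y \<otimes>\<^bsub>H\<^esub> x"
  "linear_maps K (hopf_op H) A = linear_maps K H A"
  by (simp_all add: hopf_op_def linear_maps_def)

lemma tensor_op [simp]:
  "tensor_product K (hopf_op H) A = tensor_product K H A"
  "pure_tensor K (hopf_op H) A = pure_tensor K H A"
proof -
  have f: "tensor_free (hopf_op H) A = tensor_free H A"
    by (simp add: tensor_free_def)
  have r: "tensor_relations K (hopf_op H) A = tensor_relations K H A"
    unfolding tensor_relations_def f by (simp add: hopf_op_def)
  show "tensor_product K (hopf_op H) A = tensor_product K H A"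
    unfolding tensor_product_def f r by (simp add: hopf_op_def)
  show "pure_tensor K (hopf_op H) A = pure_tensor K H A"
    by (intro ext) (simp add: pure_tensor_def f r)
qed


end

locale hopf_bijective_antipode = hopf_algebra +
  assumes bij_antipode: "bij_betw (antipode H) (carrier H) (carrier H)"
begin

abbreviation Si where "Si \<equiv> antipode_inv H"

lemma Si_closed [simp]: "h \<in> carrier H \<Longrightarrow> Si h \<in> carrier H"
  using bij_betw_inv_into[OF bij_antipode] by (auto simp: antipode_inv_def bij_betw_def)

lemma S_Si [simp]: "h \<in> carrier H \<Longrightarrow> S (Si h) = h"
  unfolding antipode_inv_def by (rule bij_betw_inv_into_right[OF bij_antipode])

lemma Si_S [simp]: "h \<in> carrier H \<Longrightarrow> Si (S h) = h"
  unfolding antipode_inv_def by (rule bij_betw_inv_into_left[OF bij_antipode])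

lemma Si_linear: "Si \<in> linear_maps K H H"
proof (rule linear_mapsI)
  fix x y assume "x \<in> carrier H" "y \<in> carrier H"
  then have "x \<oplus>\<^bsub>H\<^esub> y = S (Si x \<oplus>\<^bsub>H\<^esub> Si y)"
    by (simp add: linear_add[OF antipode_linear])
  then show "Si (x \<oplus>\<^bsub>H\<^esub> y) = Si x \<oplus>\<^bsub>H\<^esub> Si y"
    using \<open>x \<in> carrier H\<close> \<open>y \<in> carrier H\<close> by simp
next
  fix c x assume "c \<in> carrier K" "x \<in> carrier H"
  then have "c \<odot>\<^bsub>H\<^esub> x = S (c \<odot>\<^bsub>H\<^esub> Si x)"
    by (simp add: linear_smult[OF antipode_linear])
  then show "Si (c \<odot>\<^bsub>H\<^esub> x) = c \<odot>\<^bsub>H\<^esub> Si x"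
    using \<open>c \<in> carrier K\<close> \<open>x \<in> carrier H\<close> by simp
qed simp

lemma sw_Si:
  assumes P: "module K P" and h: "h \<in> carrier H" and f: "f \<in> bil P"
  shows "sw P f (Si h) = sw P (\<lambda>x y. f (Si y) (Si x)) h"
proof -
  note lin = linear_rules linear_comp[OF Si_linear]
    linear_comp[OF bilinear_left[OF f]] linear_comp[OF bilinear_right[OF f]]
  have "sw P (\<lambda>x y. f (Si y) (Si x)) (S (Si h)) = sw P (\<lambda>x y. f (Si (S x)) (Si (S y))) (Si h)"
    by (rule sw_antipode; (intro lin)?; simp add: P h)
  also have "\<dots> = sw P f (Si h)"
    by (rule sw_cong; (intro lin)?; simp add: P h)
  finally show ?thesis using h by simp
qed

text \<open>The inverse of \<open>S\<close> satisfies the antipode law with the two components exchanged: put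
  \<open>h = S k\<close>, so that \<open>Si h\<^sub>2 h\<^sub>1 = k\<^sub>1 S k\<^sub>2\<close>.\<close>

lemma sw_Si_left:
  assumes P: "module K P" and h: "h \<in> carrier H" and g: "g \<in> linear_maps K H P"
  shows "sw P (\<lambda>x y. g (Si y \<otimes>\<^bsub>H\<^esub> x)) h = \<epsilon> h \<odot>\<^bsub>P\<^esub> g \<one>\<^bsub>H\<^esub>"
proof -
  note lin = linear_rules linear_comp[OF Si_linear] linear_comp[OF g]
  have "sw P (\<lambda>x y. g (Si y \<otimes>\<^bsub>H\<^esub> x)) (S (Si h)) = sw P (\<lambda>x y. g (Si (S x) \<otimes>\<^bsub>H\<^esub> S y)) (Si h)"
    by (rule sw_antipode; (intro lin)?; simp add: P h)
  also have "\<dots> = sw P (\<lambda>x y. g (x \<otimes>\<^bsub>H\<^esub> S y)) (Si h)"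
    by (rule sw_cong; (intro lin)?; simp add: P h)
  also have "\<dots> = \<epsilon> (Si h) \<odot>\<^bsub>P\<^esub> g \<one>\<^bsub>H\<^esub>"
    by (rule sw_antipode_right) (simp_all add: P h g)
  also have "\<epsilon> (Si h) = \<epsilon> h" using counit_antipode[of "Si h"] h by simp
  finally show ?thesis using h by simp
qed

end


section \<open>Partial representations of the opposite co-opposite Hopf algebra\<close>

locale opcop_partial_representation =
  hopf_bijective_antipode K H + B: unital_algebra K B
  for K :: "('k, 'r) ring_scheme" (structure)
    and H :: "('k, 'h, 'm) hopf_algebra_scheme" (structure)
    and B :: "('k, 'b, 'l) module_scheme" (structure) +
  fixes \<gamma> :: "'h \<Rightarrow> 'b"
  assumes partial_rep: "partial_representation K (hopf_opcop K H) B \<gamma>"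
begin

lemma gamma_linear: "\<gamma> \<in> linear_maps K H B"
  and gamma_one [simp]: "\<gamma> \<one>\<^bsub>H\<^esub> = \<one>\<^bsub>B\<^esub>"
  using partial_rep by (simp_all add: partial_representation_def)

lemma gamma_closed [simp]: "h \<in> carrier H \<Longrightarrow> \<gamma> h \<in> carrier B"
  by (rule linear_closed[OF gamma_linear])

lemmas gamma_rules = linear_rules B.linear_mult_left B.linear_mult_right
  linear_comp[OF Si_linear] linear_comp[OF gamma_linear]

lemma modules [simp]: "module K H" "module K B"
  by (rule module_algebra B.module_algebra)+

text \<open>The first multiplicativity axiom, \<open>\<gamma>(h) \<gamma>(k\<^sub>2) \<gamma>(S k\<^sub>1) = \<gamma>(k\<^sub>2 h) \<gamma>(S k\<^sub>1)\<close> when written in \<open>H\<close>, at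
  \<open>Si k\<close> in place of \<open>k\<close>.\<close>

lemma gamma_absorb_left:
  assumes [simp]: "h \<in> carrier H" "k \<in> carrier H"
  shows "sw B (\<lambda>x y. \<gamma> h \<otimes>\<^bsub>B\<^esub> \<gamma> (Si x) \<otimes>\<^bsub>B\<^esub> \<gamma> y) k = sw B (\<lambda>x y. \<gamma> (Si x \<otimes>\<^bsub>H\<^esub> h) \<otimes>\<^bsub>B\<^esub> \<gamma> y) k"
proof -
  have eq: "sw B (\<lambda>x y. \<gamma> h \<otimes>\<^bsub>B\<^esub> \<gamma> y \<otimes>\<^bsub>B\<^esub> \<gamma> (S x)) (Si k)
      = sw B (\<lambda>x y. \<gamma> (y \<otimes>\<^bsub>H\<^esub> h) \<otimes>\<^bsub>B\<^esub> \<gamma> (S x)) (Si k)"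
  proof -
    have "sweedler (hopf_opcop K H) B (\<lambda>x y. \<gamma> h \<otimes>\<^bsub>B\<^esub> \<gamma> x \<otimes>\<^bsub>B\<^esub> \<gamma> (S y)) (Si k)
        = sweedler (hopf_opcop K H) B (\<lambda>x y. \<gamma> (x \<otimes>\<^bsub>H\<^esub> h) \<otimes>\<^bsub>B\<^esub> \<gamma> (S y)) (Si k)"
      using partial_rep by (simp add: partial_representation_def)
    also have "sweedler (hopf_opcop K H) B (\<lambda>x y. \<gamma> h \<otimes>\<^bsub>B\<^esub> \<gamma> x \<otimes>\<^bsub>B\<^esub> \<gamma> (S y)) (Si k)
        = sw B (\<lambda>x y. \<gamma> h \<otimes>\<^bsub>B\<^esub> \<gamma> y \<otimes>\<^bsub>B\<^esub> \<gamma> (S x)) (Si k)"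
      by (rule sweedler_opcop; (intro gamma_rules)?; simp)
    also have "sweedler (hopf_opcop K H) B (\<lambda>x y. \<gamma> (x \<otimes>\<^bsub>H\<^esub> h) \<otimes>\<^bsub>B\<^esub> \<gamma> (S y)) (Si k)
        = sw B (\<lambda>x y. \<gamma> (y \<otimes>\<^bsub>H\<^esub> h) \<otimes>\<^bsub>B\<^esub> \<gamma> (S x)) (Si k)"
      by (rule sweedler_opcop; (intro gamma_rules)?; simp)
    finally show ?thesis .
  qed
  have "sw B (\<lambda>x y. \<gamma> h \<otimes>\<^bsub>B\<^esub> \<gamma> (Si x) \<otimes>\<^bsub>B\<^esub> \<gamma> y) k
      = sw B (\<lambda>x y. \<gamma> h \<otimes>\<^bsub>B\<^esub> \<gamma> (Si x) \<otimes>\<^bsub>B\<^esub> \<gamma> (S (Si y))) k"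
    by (rule sw_cong; (intro gamma_rules)?; simp)
  also have "\<dots> = sw B (\<lambda>x y. \<gamma> h \<otimes>\<^bsub>B\<^esub> \<gamma> y \<otimes>\<^bsub>B\<^esub> \<gamma> (S x)) (Si k)"
    by (rule sw_Si[symmetric]; (intro gamma_rules)?; simp)
  also note eq
  also have "sw B (\<lambda>x y. \<gamma> (y \<otimes>\<^bsub>H\<^esub> h) \<otimes>\<^bsub>B\<^esub> \<gamma> (S x)) (Si k)
      = sw B (\<lambda>x y. \<gamma> (Si x \<otimes>\<^bsub>H\<^esub> h) \<otimes>\<^bsub>B\<^esub> \<gamma> (S (Si y))) k"
    by (rule sw_Si; (intro gamma_rules)?; simp)
  also have "\<dots> = sw B (\<lambda>x y. \<gamma> (Si x \<otimes>\<^bsub>H\<^esub> h) \<otimes>\<^bsub>B\<^esub> \<gamma> y) k"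
    by (rule sw_cong; (intro gamma_rules)?; simp)
  finally show ?thesis .
qed

text \<open>The second multiplicativity axiom, \<open>\<gamma>(h\<^sub>2) \<gamma>(S h\<^sub>1) \<gamma>(k) = \<gamma>(h\<^sub>2) \<gamma>(k S h\<^sub>1)\<close> when written in \<open>H\<close>, at
  \<open>Si h\<close> in place of \<open>h\<close>.\<close>

lemma gamma_absorb_right:
  assumes [simp]: "h \<in> carrier H" "k \<in> carrier H"
  shows "sw B (\<lambda>x y. \<gamma> (Si x) \<otimes>\<^bsub>B\<^esub> \<gamma> y \<otimes>\<^bsub>B\<^esub> \<gamma> k) h = sw B (\<lambda>x y. \<gamma> (Si x) \<otimes>\<^bsub>B\<^esub> \<gamma> (k \<otimes>\<^bsub>H\<^esub> y)) h"
proof -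
  have eq: "sw B (\<lambda>x y. \<gamma> y \<otimes>\<^bsub>B\<^esub> \<gamma> (S x) \<otimes>\<^bsub>B\<^esub> \<gamma> k) (Si h)
      = sw B (\<lambda>x y. \<gamma> y \<otimes>\<^bsub>B\<^esub> \<gamma> (k \<otimes>\<^bsub>H\<^esub> S x)) (Si h)"
  proof -
    have "sweedler (hopf_opcop K H) B (\<lambda>x y. \<gamma> x \<otimes>\<^bsub>B\<^esub> \<gamma> (S y) \<otimes>\<^bsub>B\<^esub> \<gamma> k) (Si h)
        = sweedler (hopf_opcop K H) B (\<lambda>x y. \<gamma> x \<otimes>\<^bsub>B\<^esub> \<gamma> (k \<otimes>\<^bsub>H\<^esub> S y)) (Si h)"
      using partial_rep by (simp add: partial_representation_def)
    also have "sweedler (hopf_opcop K H) B (\<lambda>x y. \<gamma> x \<otimes>\<^bsub>B\<^esub> \<gamma> (S y) \<otimes>\<^bsub>B\<^esub> \<gamma> k) (Si h)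
        = sw B (\<lambda>x y. \<gamma> y \<otimes>\<^bsub>B\<^esub> \<gamma> (S x) \<otimes>\<^bsub>B\<^esub> \<gamma> k) (Si h)"
      by (rule sweedler_opcop; (intro gamma_rules)?; simp)
    also have "sweedler (hopf_opcop K H) B (\<lambda>x y. \<gamma> x \<otimes>\<^bsub>B\<^esub> \<gamma> (k \<otimes>\<^bsub>H\<^esub> S y)) (Si h)
        = sw B (\<lambda>x y. \<gamma> y \<otimes>\<^bsub>B\<^esub> \<gamma> (k \<otimes>\<^bsub>H\<^esub> S x)) (Si h)"
      by (rule sweedler_opcop; (intro gamma_rules)?; simp)
    finally show ?thesis .
  qed
  have "sw B (\<lambda>x y. \<gamma> (Si x) \<otimes>\<^bsub>B\<^esub> \<gamma> y \<otimes>\<^bsub>B\<^esub> \<gamma> k) h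
      = sw B (\<lambda>x y. \<gamma> (Si x) \<otimes>\<^bsub>B\<^esub> \<gamma> (S (Si y)) \<otimes>\<^bsub>B\<^esub> \<gamma> k) h"
    by (rule sw_cong; (intro gamma_rules)?; simp)
  also have "\<dots> = sw B (\<lambda>x y. \<gamma> y \<otimes>\<^bsub>B\<^esub> \<gamma> (S x) \<otimes>\<^bsub>B\<^esub> \<gamma> k) (Si h)"
    by (rule sw_Si[symmetric]; (intro gamma_rules)?; simp)
  also note eq
  also have "sw B (\<lambda>x y. \<gamma> y \<otimes>\<^bsub>B\<^esub> \<gamma> (k \<otimes>\<^bsub>H\<^esub> S x)) (Si h)
      = sw B (\<lambda>x y. \<gamma> (Si x) \<otimes>\<^bsub>B\<^esub> \<gamma> (k \<otimes>\<^bsub>H\<^esub> S (Si y))) h"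
    by (rule sw_Si; (intro gamma_rules)?; simp)
  also have "\<dots> = sw B (\<lambda>x y. \<gamma> (Si x) \<otimes>\<^bsub>B\<^esub> \<gamma> (k \<otimes>\<^bsub>H\<^esub> y)) h"
    by (rule sw_cong; (intro gamma_rules)?; simp)
  finally show ?thesis .
qed

text \<open>Absorb the last factor: \<open>\<gamma>(Si h\<^sub>1) \<gamma>(h\<^sub>2) \<gamma>(Si h\<^sub>3) = \<gamma>(Si h\<^sub>1) \<gamma>(Si h\<^sub>3 h\<^sub>2) = \<gamma>(Si h)\<close>.\<close>

lemma gamma_regular_Si:
  assumes [simp]: "h \<in> carrier H"
  shows "sw B (\<lambda>x y. sw B (\<lambda>u v. \<gamma> (Si x) \<otimes>\<^bsub>B\<^esub> \<gamma> u \<otimes>\<^bsub>B\<^esub> \<gamma> (Si v)) y) h = \<gamma> (Si h)"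
proof -
  have "sw B (\<lambda>x y. sw B (\<lambda>u v. \<gamma> (Si x) \<otimes>\<^bsub>B\<^esub> \<gamma> u \<otimes>\<^bsub>B\<^esub> \<gamma> (Si v)) y) h
      = sw B (\<lambda>x y. sw B (\<lambda>u v. \<gamma> (Si u) \<otimes>\<^bsub>B\<^esub> \<gamma> v \<otimes>\<^bsub>B\<^esub> \<gamma> (Si y)) x) h"
    by (rule sw_coassoc[symmetric]; (intro gamma_rules)?; simp)
  also have "\<dots> = sw B (\<lambda>x y. sw B (\<lambda>u v. \<gamma> (Si u) \<otimes>\<^bsub>B\<^esub> \<gamma> (Si y \<otimes>\<^bsub>H\<^esub> v)) x) h"
    by (rule sw_cong; (intro gamma_rules)?; (rule gamma_absorb_right)?; simp)
  also have "\<dots> = sw B (\<lambda>x y. sw B (\<lambda>u v. \<gamma> (Si x) \<otimes>\<^bsub>B\<^esub> \<gamma> (Si v \<otimes>\<^bsub>H\<^esub> u)) y) h"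
    by (rule sw_coassoc; (intro gamma_rules)?; simp)
  also have "\<dots> = sw B (\<lambda>x y. \<epsilon> y \<odot>\<^bsub>B\<^esub> (\<gamma> (Si x) \<otimes>\<^bsub>B\<^esub> \<gamma> \<one>\<^bsub>H\<^esub>)) h"
    by (rule sw_cong; (intro gamma_rules)?; (rule sw_Si_left; (intro gamma_rules)?)?; simp)
  also have "\<dots> = \<gamma> (Si h) \<otimes>\<^bsub>B\<^esub> \<gamma> \<one>\<^bsub>H\<^esub>"
    by (rule sw_counit_right; (intro gamma_rules)?; simp)
  finally show ?thesis by simp
qed

text \<open>Absorb the first factor: \<open>\<gamma>(h\<^sub>1) \<gamma>(Si h\<^sub>2) \<gamma>(h\<^sub>3) = \<gamma>(Si h\<^sub>2 h\<^sub>1) \<gamma>(h\<^sub>3) = \<gamma>(h)\<close>.\<close>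

lemma gamma_regular:
  assumes [simp]: "h \<in> carrier H"
  shows "sw B (\<lambda>x y. sw B (\<lambda>u v. \<gamma> x \<otimes>\<^bsub>B\<^esub> \<gamma> (Si u) \<otimes>\<^bsub>B\<^esub> \<gamma> v) y) h = \<gamma> h"
proof -
  have "sw B (\<lambda>x y. sw B (\<lambda>u v. \<gamma> x \<otimes>\<^bsub>B\<^esub> \<gamma> (Si u) \<otimes>\<^bsub>B\<^esub> \<gamma> v) y) h
      = sw B (\<lambda>x y. sw B (\<lambda>u v. \<gamma> (Si u \<otimes>\<^bsub>H\<^esub> x) \<otimes>\<^bsub>B\<^esub> \<gamma> v) y) h"
    by (rule sw_cong; (intro gamma_rules)?; (rule gamma_absorb_left)?; simp)
  also have "\<dots> = sw B (\<lambda>x y. sw B (\<lambda>u v. \<gamma> (Si v \<otimes>\<^bsub>H\<^esub> u) \<otimes>\<^bsub>B\<^esub> \<gamma> y) x) h"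
    by (rule sw_coassoc[symmetric]; (intro gamma_rules)?; simp)
  also have "\<dots> = sw B (\<lambda>x y. \<epsilon> x \<odot>\<^bsub>B\<^esub> (\<gamma> \<one>\<^bsub>H\<^esub> \<otimes>\<^bsub>B\<^esub> \<gamma> y)) h"
    by (rule sw_cong; (intro gamma_rules)?; (rule sw_Si_left; (intro gamma_rules)?)?; simp)
  also have "\<dots> = \<gamma> \<one>\<^bsub>H\<^esub> \<otimes>\<^bsub>B\<^esub> \<gamma> h"
    by (rule sw_counit_left; (intro gamma_rules)?; simp)
  finally show ?thesis by simp
qed

text \<open>A multiplicativity law with \<open>Si\<close> on the last factor, derived from the two axioms: expand \<open>\<gamma>(Si h\<^sub>2)\<close> as
  \<open>\<gamma>(Si h\<^sub>2) \<gamma>(h\<^sub>3) \<gamma>(Si h\<^sub>4)\<close>; then the first two of these factors absorb \<open>\<gamma>(h\<^sub>1 k)\<close>, leaving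
  \<open>\<gamma>(Si h\<^sub>2 h\<^sub>1 k) \<gamma>(h\<^sub>3) \<gamma>(Si h\<^sub>4) = \<gamma>(k) \<gamma>(h\<^sub>1) \<gamma>(Si h\<^sub>2)\<close>.\<close>

lemma gamma_mult_absorb:
  assumes [simp]: "h \<in> carrier H" "k \<in> carrier H"
  shows "sw B (\<lambda>x y. \<gamma> (x \<otimes>\<^bsub>H\<^esub> k) \<otimes>\<^bsub>B\<^esub> \<gamma> (Si y)) h = sw B (\<lambda>x y. \<gamma> k \<otimes>\<^bsub>B\<^esub> \<gamma> x \<otimes>\<^bsub>B\<^esub> \<gamma> (Si y)) h"
proof -
  note left = sw_mult_left[OF B.unital_algebra_axioms]
    and right = sw_mult_right[OF B.unital_algebra_axioms]
  have expand: "\<gamma> (x \<otimes>\<^bsub>H\<^esub> k) \<otimes>\<^bsub>B\<^esub> \<gamma> (Si y) =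
      sw B (\<lambda>p q. sw B (\<lambda>u v. \<gamma> (Si p \<otimes>\<^bsub>H\<^esub> (x \<otimes>\<^bsub>H\<^esub> k)) \<otimes>\<^bsub>B\<^esub> \<gamma> u \<otimes>\<^bsub>B\<^esub> \<gamma> (Si v)) q) y"
    if [simp]: "x \<in> carrier H" "y \<in> carrier H" for x y
  proof -
    let ?c = "\<gamma> (x \<otimes>\<^bsub>H\<^esub> k)"
    have inner: "?c \<otimes>\<^bsub>B\<^esub> sw B (\<lambda>u v. \<gamma> (Si p) \<otimes>\<^bsub>B\<^esub> \<gamma> u \<otimes>\<^bsub>B\<^esub> \<gamma> (Si v)) q
      = sw B (\<lambda>u v. ?c \<otimes>\<^bsub>B\<^esub> \<gamma> (Si p) \<otimes>\<^bsub>B\<^esub> \<gamma> u \<otimes>\<^bsub>B\<^esub> \<gamma> (Si v)) q"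
      if [simp]: "p \<in> carrier H" "q \<in> carrier H" for p q
    proof -
      have "?c \<otimes>\<^bsub>B\<^esub> sw B (\<lambda>u v. \<gamma> (Si p) \<otimes>\<^bsub>B\<^esub> \<gamma> u \<otimes>\<^bsub>B\<^esub> \<gamma> (Si v)) q
        = sw B (\<lambda>u v. ?c \<otimes>\<^bsub>B\<^esub> (\<gamma> (Si p) \<otimes>\<^bsub>B\<^esub> \<gamma> u \<otimes>\<^bsub>B\<^esub> \<gamma> (Si v))) q"
        by (rule left; (intro gamma_rules)?; simp)
      also have "\<dots> = sw B (\<lambda>u v. ?c \<otimes>\<^bsub>B\<^esub> \<gamma> (Si p) \<otimes>\<^bsub>B\<^esub> \<gamma> u \<otimes>\<^bsub>B\<^esub> \<gamma> (Si v)) q"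
        by (rule sw_cong; (intro gamma_rules)?; simp add: B.m_assoc)
      finally show ?thesis .
    qed
    have group: "sw B (\<lambda>p u. ?c \<otimes>\<^bsub>B\<^esub> \<gamma> (Si p) \<otimes>\<^bsub>B\<^esub> \<gamma> u \<otimes>\<^bsub>B\<^esub> \<gamma> (Si v)) q
      = sw B (\<lambda>p u. \<gamma> (Si p \<otimes>\<^bsub>H\<^esub> (x \<otimes>\<^bsub>H\<^esub> k)) \<otimes>\<^bsub>B\<^esub> \<gamma> u \<otimes>\<^bsub>B\<^esub> \<gamma> (Si v)) q"
      if [simp]: "v \<in> carrier H" "q \<in> carrier H" for v q
    proof -
      have "sw B (\<lambda>p u. ?c \<otimes>\<^bsub>B\<^esub> \<gamma> (Si p) \<otimes>\<^bsub>B\<^esub> \<gamma> u \<otimes>\<^bsub>B\<^esub> \<gamma> (Si v)) q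
        = sw B (\<lambda>p u. ?c \<otimes>\<^bsub>B\<^esub> \<gamma> (Si p) \<otimes>\<^bsub>B\<^esub> \<gamma> u) q \<otimes>\<^bsub>B\<^esub> \<gamma> (Si v)"
        by (rule right[symmetric]; (intro gamma_rules)?; simp)
      also have "sw B (\<lambda>p u. ?c \<otimes>\<^bsub>B\<^esub> \<gamma> (Si p) \<otimes>\<^bsub>B\<^esub> \<gamma> u) q
        = sw B (\<lambda>p u. \<gamma> (Si p \<otimes>\<^bsub>H\<^esub> (x \<otimes>\<^bsub>H\<^esub> k)) \<otimes>\<^bsub>B\<^esub> \<gamma> u) q"
        by (rule gamma_absorb_left) simp_all
      also have "\<dots> \<otimes>\<^bsub>B\<^esub> \<gamma> (Si v)
        = sw B (\<lambda>p u. \<gamma> (Si p \<otimes>\<^bsub>H\<^esub> (x \<otimes>\<^bsub>H\<^esub> k)) \<otimes>\<^bsub>B\<^esub> \<gamma> u \<otimes>\<^bsub>B\<^esub> \<gamma> (Si v)) q"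
        by (rule right; (intro gamma_rules)?; simp)
      finally show ?thesis .
    qed
    have "?c \<otimes>\<^bsub>B\<^esub> \<gamma> (Si y)
      = ?c \<otimes>\<^bsub>B\<^esub> sw B (\<lambda>p q. sw B (\<lambda>u v. \<gamma> (Si p) \<otimes>\<^bsub>B\<^esub> \<gamma> u \<otimes>\<^bsub>B\<^esub> \<gamma> (Si v)) q) y"
      by (simp add: gamma_regular_Si)
    also have "\<dots> = sw B (\<lambda>p q. ?c \<otimes>\<^bsub>B\<^esub> sw B (\<lambda>u v. \<gamma> (Si p) \<otimes>\<^bsub>B\<^esub> \<gamma> u \<otimes>\<^bsub>B\<^esub> \<gamma> (Si v)) q) y"
      by (rule left; (intro gamma_rules)?; simp)
    also have "\<dots> = sw B (\<lambda>p q. sw B (\<lambda>u v. ?c \<otimes>\<^bsub>B\<^esub> \<gamma> (Si p) \<otimes>\<^bsub>B\<^esub> \<gamma> u \<otimes>\<^bsub>B\<^esub> \<gamma> (Si v)) q) y"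
      by (rule sw_cong; (intro gamma_rules)?; (rule inner)?; simp)
    also have "\<dots> = sw B (\<lambda>q v. sw B (\<lambda>p u. ?c \<otimes>\<^bsub>B\<^esub> \<gamma> (Si p) \<otimes>\<^bsub>B\<^esub> \<gamma> u \<otimes>\<^bsub>B\<^esub> \<gamma> (Si v)) q) y"
      by (rule sw_coassoc[symmetric]; (intro gamma_rules)?; simp)
    also have "\<dots> = sw B (\<lambda>q v. sw B (\<lambda>p u.
        \<gamma> (Si p \<otimes>\<^bsub>H\<^esub> (x \<otimes>\<^bsub>H\<^esub> k)) \<otimes>\<^bsub>B\<^esub> \<gamma> u \<otimes>\<^bsub>B\<^esub> \<gamma> (Si v)) q) y"
      by (rule sw_cong; (intro gamma_rules)?; (rule group)?; simp)
    also have "\<dots> = sw B (\<lambda>p q. sw B (\<lambda>u v.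
        \<gamma> (Si p \<otimes>\<^bsub>H\<^esub> (x \<otimes>\<^bsub>H\<^esub> k)) \<otimes>\<^bsub>B\<^esub> \<gamma> u \<otimes>\<^bsub>B\<^esub> \<gamma> (Si v)) q) y"
      by (rule sw_coassoc; (intro gamma_rules)?; simp)
    finally show ?thesis .
  qed
  have "sw B (\<lambda>x y. \<gamma> (x \<otimes>\<^bsub>H\<^esub> k) \<otimes>\<^bsub>B\<^esub> \<gamma> (Si y)) h = sw B (\<lambda>x y. sw B (\<lambda>p q. sw B (\<lambda>u v.
        \<gamma> (Si p \<otimes>\<^bsub>H\<^esub> (x \<otimes>\<^bsub>H\<^esub> k)) \<otimes>\<^bsub>B\<^esub> \<gamma> u \<otimes>\<^bsub>B\<^esub> \<gamma> (Si v)) q) y) h"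
    by (rule sw_cong; (intro gamma_rules)?; (rule expand)?; simp)
  also have "\<dots> = sw B (\<lambda>z q. sw B (\<lambda>x p. sw B (\<lambda>u v.
        \<gamma> (Si p \<otimes>\<^bsub>H\<^esub> (x \<otimes>\<^bsub>H\<^esub> k)) \<otimes>\<^bsub>B\<^esub> \<gamma> u \<otimes>\<^bsub>B\<^esub> \<gamma> (Si v)) q) z) h"
    by (rule sw_coassoc[symmetric]; (intro gamma_rules)?; simp)
  also have "\<dots> = sw B (\<lambda>z q. sw B (\<lambda>x p. sw B (\<lambda>u v.
        \<gamma> (Si p \<otimes>\<^bsub>H\<^esub> x \<otimes>\<^bsub>H\<^esub> k) \<otimes>\<^bsub>B\<^esub> \<gamma> u \<otimes>\<^bsub>B\<^esub> \<gamma> (Si v)) q) z) h"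
    by (intro sw_cong gamma_rules; simp add: m_assoc)
  also have "\<dots> = sw B (\<lambda>z q. \<epsilon> z \<odot>\<^bsub>B\<^esub> sw B (\<lambda>u v.
        \<gamma> (\<one>\<^bsub>H\<^esub> \<otimes>\<^bsub>H\<^esub> k) \<otimes>\<^bsub>B\<^esub> \<gamma> u \<otimes>\<^bsub>B\<^esub> \<gamma> (Si v)) q) h"
    by (rule sw_cong; (intro gamma_rules)?; (rule sw_Si_left; (intro gamma_rules)?)?; simp)
  also have "\<dots> = sw B (\<lambda>u v. \<gamma> (\<one>\<^bsub>H\<^esub> \<otimes>\<^bsub>H\<^esub> k) \<otimes>\<^bsub>B\<^esub> \<gamma> u \<otimes>\<^bsub>B\<^esub> \<gamma> (Si v)) h"
    by (rule sw_counit_left; (intro gamma_rules)?; simp)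
  finally show ?thesis by simp
qed

end


section \<open>The partial smash product\<close>

locale right_partial_op_action =
  hopf_algebra K H + A: unital_algebra K A
  for K :: "('k, 'r) ring_scheme" (structure)
    and H :: "('k, 'h, 'm) hopf_algebra_scheme" (structure)
    and A :: "('k, 'a, 'n) module_scheme" (structure) +
  fixes act :: "'a \<Rightarrow> 'h \<Rightarrow> 'a"
  assumes action: "right_partial_action K (hopf_op H) A act"
begin

lemma act_linear_right: "a \<in> carrier A \<Longrightarrow> (\<lambda>h. act a h) \<in> linear_maps K H A"
  and act_linear_left: "h \<in> carrier H \<Longrightarrow> (\<lambda>a. act a h) \<in> linear_maps K A A"
  and act_one [simp]: "a \<in> carrier A \<Longrightarrow> act a \<one>\<^bsub>H\<^esub> = a"
  and act_mult: "\<lbrakk>a \<in> carrier A; b \<in> carrier A; h \<in> carrier H\<rbrakk> \<Longrightarrow>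
    act (a \<otimes>\<^bsub>A\<^esub> b) h = sw A (\<lambda>x y. act a x \<otimes>\<^bsub>A\<^esub> act b y) h"
  and act_act: "\<lbrakk>a \<in> carrier A; h \<in> carrier H; k \<in> carrier H\<rbrakk> \<Longrightarrow>
    act (act a k) h = sw A (\<lambda>x y. act a (x \<otimes>\<^bsub>H\<^esub> k) \<otimes>\<^bsub>A\<^esub> act \<one>\<^bsub>A\<^esub> y) h"
  using action by (simp_all add: right_partial_action_def sweedler_op)

lemma act_closed [simp]: "\<lbrakk>a \<in> carrier A; h \<in> carrier H\<rbrakk> \<Longrightarrow> act a h \<in> carrier A"
  by (rule linear_closed[OF act_linear_right])

sublocale HA: module_pair K H A
  by (intro module_pair.intro module_algebra A.module_algebra)

notation HA.pure (infix \<open>\<star>\<close> 66)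

lemma action_modules [simp]: "module K H" "module K A" "module K HA.T"
  by (rule module_algebra A.module_algebra HA.module_T)+

lemmas action_rules = linear_rules A.linear_mult_left A.linear_mult_right
  linear_comp[OF act_linear_left] linear_comp[OF act_linear_right]
  linear_comp[OF bilinear_left[OF HA.pure_bilinear]] linear_comp[OF bilinear_right[OF HA.pure_bilinear]]

lemmas [simp] = HA.pure_closed

text \<open>Distribute the action over the product, merge the two actions on \<open>1\<close>, and contract
  \<open>(1 \<cdot> h\<^sub>2)(b \<cdot> h\<^sub>3) = b \<cdot> h\<^sub>2\<close>.\<close>

lemma act_truncated:
  assumes [simp]: "b \<in> carrier A" "h \<in> carrier H" "k \<in> carrier H"
  shows "act (act \<one>\<^bsub>A\<^esub> k \<otimes>\<^bsub>A\<^esub> b) h = sw A (\<lambda>x y. act \<one>\<^bsub>A\<^esub> (x \<otimes>\<^bsub>H\<^esub> k) \<otimes>\<^bsub>A\<^esub> act b y) h"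
proof -
  let ?g = "\<lambda>x u v. act \<one>\<^bsub>A\<^esub> (x \<otimes>\<^bsub>H\<^esub> k) \<otimes>\<^bsub>A\<^esub> act \<one>\<^bsub>A\<^esub> u \<otimes>\<^bsub>A\<^esub> act b v"
  have "act (act \<one>\<^bsub>A\<^esub> k \<otimes>\<^bsub>A\<^esub> b) h = sw A (\<lambda>z v. act (act \<one>\<^bsub>A\<^esub> k) z \<otimes>\<^bsub>A\<^esub> act b v) h"
    by (rule act_mult) simp_all
  also have "\<dots> = sw A (\<lambda>z v. sw A (\<lambda>x u. ?g x u v) z) h"
  proof (rule sw_cong)
    fix z v assume [simp]: "z \<in> carrier H" "v \<in> carrier H"
    show "act (act \<one>\<^bsub>A\<^esub> k) z \<otimes>\<^bsub>A\<^esub> act b v = sw A (\<lambda>x u. ?g x u v) z"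
      unfolding act_act[OF A.one_closed \<open>z \<in> carrier H\<close> \<open>k \<in> carrier H\<close>]
      by (rule sw_mult_right[OF A.unital_algebra_axioms]; (intro action_rules)?; simp)
  qed ((intro action_rules)?; simp)+
  also have "\<dots> = sw A (\<lambda>x y. sw A (\<lambda>u v. ?g x u v) y) h"
    by (rule sw_coassoc; (intro action_rules)?; simp)
  also have "\<dots> = sw A (\<lambda>x y. act \<one>\<^bsub>A\<^esub> (x \<otimes>\<^bsub>H\<^esub> k) \<otimes>\<^bsub>A\<^esub> act b y) h"
  proof (rule sw_cong)
    fix x y assume [simp]: "x \<in> carrier H" "y \<in> carrier H"
    have "sw A (\<lambda>u v. ?g x u v) y
      = sw A (\<lambda>u v. act \<one>\<^bsub>A\<^esub> (x \<otimes>\<^bsub>H\<^esub> k) \<otimes>\<^bsub>A\<^esub> (act \<one>\<^bsub>A\<^esub> u \<otimes>\<^bsub>A\<^esub> act b v)) y"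
      by (rule sw_cong; (intro action_rules)?; simp add: A.m_assoc)
    also have "\<dots> = act \<one>\<^bsub>A\<^esub> (x \<otimes>\<^bsub>H\<^esub> k) \<otimes>\<^bsub>A\<^esub> sw A (\<lambda>u v. act \<one>\<^bsub>A\<^esub> u \<otimes>\<^bsub>A\<^esub> act b v) y"
      by (rule sw_mult_left[OF A.unital_algebra_axioms, symmetric]; (intro action_rules)?; simp)
    also have "sw A (\<lambda>u v. act \<one>\<^bsub>A\<^esub> u \<otimes>\<^bsub>A\<^esub> act b v) y = act b y"
      using act_mult[of "\<one>\<^bsub>A\<^esub>" b y] by simp
    finally show "sw A (\<lambda>u v. ?g x u v) y = act \<one>\<^bsub>A\<^esub> (x \<otimes>\<^bsub>H\<^esub> k) \<otimes>\<^bsub>A\<^esub> act b y" .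
  qed ((intro action_rules)?; simp)+
  finally show ?thesis .
qed

abbreviation smash (infix \<open>\<bullet>\<close> 64)
  where "s \<bullet> t \<equiv> smash_mult K (hopf_op H) A act s t"

abbreviation smash_pure_tensors where
  "smash_pure_tensors k b h a \<equiv> sw HA.T (\<lambda>x y. (x \<otimes>\<^bsub>H\<^esub> k) \<star> (act b y \<otimes>\<^bsub>A\<^esub> a)) h"

lemma smash_def:
  "s \<bullet> t = tensor_lift HA.T (\<lambda>k b. tensor_lift HA.T (\<lambda>h a. smash_pure_tensors k b h a) t) s"
  by (simp add: smash_mult_def Let_def sweedler_op)

lemma bilinear_smash_right:
  assumes [simp]: "k \<in> carrier H" "b \<in> carrier A"
  shows "(\<lambda>h a. smash_pure_tensors k b h a) \<in> bilinear_maps K H A HA.T"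
  by (intro action_rules; simp)

lemma bilinear_smash_left:
  assumes [simp]: "t \<in> carrier HA.T"
  shows "(\<lambda>k b. tensor_lift HA.T (\<lambda>h a. smash_pure_tensors k b h a) t) \<in> bilinear_maps K H A HA.T"
  by (intro action_rules HA.tensor_lift_parameter; simp?; (intro action_rules)?; simp)

lemma linear_smash_left: "t \<in> carrier HA.T \<Longrightarrow> (\<lambda>s. s \<bullet> t) \<in> linear_maps K HA.T HA.T"
  unfolding smash_def by (intro HA.tensor_lift_linear bilinear_smash_left) simp_all

lemma linear_smash_right: "s \<in> carrier HA.T \<Longrightarrow> (\<lambda>t. s \<bullet> t) \<in> linear_maps K HA.T HA.T"
  unfolding smash_def
  by (rule HA.tensor_lift_parameter[OF _ _ bilinear_smash_left])
    (simp_all add: HA.tensor_lift_linear[OF _ bilinear_smash_right])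

lemma smash_closed [simp]: "s \<in> carrier HA.T \<Longrightarrow> t \<in> carrier HA.T \<Longrightarrow> s \<bullet> t \<in> carrier HA.T"
  by (rule linear_closed[OF linear_smash_left])

lemma smash_pure:
  assumes [simp]: "k \<in> carrier H" "b \<in> carrier A" "h \<in> carrier H" "a \<in> carrier A"
  shows "(k \<star> b) \<bullet> (h \<star> a) = smash_pure_tensors k b h a"
  by (simp add: smash_def HA.tensor_lift_pure[OF _ bilinear_smash_left]
      HA.tensor_lift_pure[OF _ bilinear_smash_right])

abbreviation unit where "unit \<equiv> \<one>\<^bsub>H\<^esub> \<star> \<one>\<^bsub>A\<^esub>"

lemma unit_smash_pure:
  assumes [simp]: "h \<in> carrier H" "a \<in> carrier A"
  shows "unit \<bullet> (h \<star> a) = sw HA.T (\<lambda>x y. x \<star> (act \<one>\<^bsub>A\<^esub> y \<otimes>\<^bsub>A\<^esub> a)) h"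
  unfolding smash_pure[OF one_closed A.one_closed assms]
  by (rule sw_cong; (intro action_rules)?; simp)

lemma smash_elem_eq:
  assumes "h \<in> carrier H" "a \<in> carrier A"
  shows "smash_elem K (hopf_op H) A act h a = unit \<bullet> (h \<star> a)"
  by (simp add: smash_elem_def sweedler_op unit_smash_pure assms)

text \<open>The instance of associativity that makes the image of \<open>t \<mapsto> (1 \<otimes> 1) t\<close> closed under the product. On
  pure tensors \<open>k \<otimes> b\<close> and \<open>h \<otimes> a\<close> both sides are \<open>h\<^sub>1 k\<^sub>1 \<otimes> (1 \<cdot> h\<^sub>2 k\<^sub>2)(b \<cdot> h\<^sub>3) a\<close>, by
  \<open>act_truncated\<close> on the left and multiplicativity of the comultiplication on the right.\<close>

lemma smash_unit_assoc:
  assumes s: "s \<in> carrier HA.T" and t: "t \<in> carrier HA.T"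
  shows "(unit \<bullet> s) \<bullet> t = unit \<bullet> (s \<bullet> t)"
proof -
  have pure: "(unit \<bullet> (k \<star> b)) \<bullet> (h \<star> a) = unit \<bullet> ((k \<star> b) \<bullet> (h \<star> a))"
    if [simp]: "k \<in> carrier H" "b \<in> carrier A" "h \<in> carrier H" "a \<in> carrier A" for k b h a
  proof -
    let ?g = "\<lambda>u v p q y. (u \<otimes>\<^bsub>H\<^esub> p) \<star> (act \<one>\<^bsub>A\<^esub> (v \<otimes>\<^bsub>H\<^esub> q) \<otimes>\<^bsub>A\<^esub> act b y \<otimes>\<^bsub>A\<^esub> a)"
    have "(unit \<bullet> (k \<star> b)) \<bullet> (h \<star> a) = sw HA.T (\<lambda>p q. p \<star> (act \<one>\<^bsub>A\<^esub> q \<otimes>\<^bsub>A\<^esub> b)) k \<bullet> (h \<star> a)"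
      by (simp add: unit_smash_pure)
    also have "\<dots> = sw HA.T (\<lambda>p q. (p \<star> (act \<one>\<^bsub>A\<^esub> q \<otimes>\<^bsub>A\<^esub> b)) \<bullet> (h \<star> a)) k"
      by (rule linear_sw[of _ _ _ _ "\<lambda>s. s \<bullet> (h \<star> a)"]; (intro action_rules linear_smash_left)?; simp)
    also have "\<dots> = sw HA.T (\<lambda>p q. sw HA.T (\<lambda>x y. sw HA.T (\<lambda>u v. ?g u v p q y) x) h) k"
    proof (rule sw_cong)
      fix p q assume [simp]: "p \<in> carrier H" "q \<in> carrier H"
      have "(p \<star> (act \<one>\<^bsub>A\<^esub> q \<otimes>\<^bsub>A\<^esub> b)) \<bullet> (h \<star> a) = smash_pure_tensors p (act \<one>\<^bsub>A\<^esub> q \<otimes>\<^bsub>A\<^esub> b) h a"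
        by (simp add: smash_pure)
      also have "\<dots> = sw HA.T (\<lambda>u y. sw HA.T (\<lambda>v w. ?g u v p q w) y) h"
      proof (rule sw_cong)
        fix u y assume [simp]: "u \<in> carrier H" "y \<in> carrier H"
        have "(\<lambda>c. (u \<otimes>\<^bsub>H\<^esub> p) \<star> (c \<otimes>\<^bsub>A\<^esub> a)) \<in> linear_maps K A HA.T"
          by (intro action_rules; simp)
        from linear_sw[OF _ _ _ _ this, of y "\<lambda>v w. act \<one>\<^bsub>A\<^esub> (v \<otimes>\<^bsub>H\<^esub> q) \<otimes>\<^bsub>A\<^esub> act b w"]
        show "(u \<otimes>\<^bsub>H\<^esub> p) \<star> (act (act \<one>\<^bsub>A\<^esub> q \<otimes>\<^bsub>A\<^esub> b) y \<otimes>\<^bsub>A\<^esub> a) = sw HA.T (\<lambda>v w. ?g u v p q w) y"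
          unfolding act_truncated[OF \<open>b \<in> carrier A\<close> \<open>y \<in> carrier H\<close> \<open>q \<in> carrier H\<close>]
          by (rule meta_mp; (intro action_rules)?; simp)
      qed ((intro action_rules)?; simp)+
      also have "\<dots> = sw HA.T (\<lambda>x y. sw HA.T (\<lambda>u v. ?g u v p q y) x) h"
        by (rule sw_coassoc[symmetric]; (intro action_rules)?; simp)
      finally show "(p \<star> (act \<one>\<^bsub>A\<^esub> q \<otimes>\<^bsub>A\<^esub> b)) \<bullet> (h \<star> a)
        = sw HA.T (\<lambda>x y. sw HA.T (\<lambda>u v. ?g u v p q y) x) h" .
    qed ((intro bilinear_comp[OF linear_smash_left] action_rules)?; simp)+
    also have "\<dots> = sw HA.T (\<lambda>x y. sw HA.T (\<lambda>p q. sw HA.T (\<lambda>u v. ?g u v p q y) x) k) h"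
      by (rule sw_swap; (intro action_rules)?; simp)
    also have "\<dots> = sw HA.T (\<lambda>x y. sw HA.T (\<lambda>u v. sw HA.T (\<lambda>p q. ?g u v p q y) k) x) h"
      by (rule sw_cong; (rule sw_swap)?; (intro action_rules)?; simp)
    also have "\<dots> = sw HA.T (\<lambda>x y. unit \<bullet> ((x \<otimes>\<^bsub>H\<^esub> k) \<star> (act b y \<otimes>\<^bsub>A\<^esub> a))) h"
    proof (rule sw_cong)
      fix x y assume [simp]: "x \<in> carrier H" "y \<in> carrier H"
      have "unit \<bullet> ((x \<otimes>\<^bsub>H\<^esub> k) \<star> (act b y \<otimes>\<^bsub>A\<^esub> a))
        = sw HA.T (\<lambda>u v. u \<star> (act \<one>\<^bsub>A\<^esub> v \<otimes>\<^bsub>A\<^esub> (act b y \<otimes>\<^bsub>A\<^esub> a))) (x \<otimes>\<^bsub>H\<^esub> k)"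
        by (simp add: unit_smash_pure)
      also have "\<dots> = sw HA.T (\<lambda>u v. sw HA.T (\<lambda>p q.
          (u \<otimes>\<^bsub>H\<^esub> p) \<star> (act \<one>\<^bsub>A\<^esub> (v \<otimes>\<^bsub>H\<^esub> q) \<otimes>\<^bsub>A\<^esub> (act b y \<otimes>\<^bsub>A\<^esub> a))) k) x"
        by (rule sw_mult; (intro action_rules)?; simp)
      also have "\<dots> = sw HA.T (\<lambda>u v. sw HA.T (\<lambda>p q. ?g u v p q y) k) x"
        by (intro sw_cong action_rules; simp add: A.m_assoc)
      finally show "sw HA.T (\<lambda>u v. sw HA.T (\<lambda>p q. ?g u v p q y) k) x
        = unit \<bullet> ((x \<otimes>\<^bsub>H\<^esub> k) \<star> (act b y \<otimes>\<^bsub>A\<^esub> a))" by simp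
    qed ((intro action_rules)?; simp)+
    also have "\<dots> = unit \<bullet> smash_pure_tensors k b h a"
      by (rule linear_sw[of _ _ _ _ "\<lambda>s. unit \<bullet> s", symmetric];
          (intro action_rules linear_smash_right)?; simp)
    finally show ?thesis by (simp add: smash_pure)
  qed
  note linear = linear_comp[OF linear_smash_left] linear_comp[OF linear_smash_right]
  have "(unit \<bullet> (k \<star> b)) \<bullet> t = unit \<bullet> ((k \<star> b) \<bullet> t)"
    if [simp]: "k \<in> carrier H" "b \<in> carrier A" for k b
  proof (rule HA.linear_eq_on_pure[OF _ _ _ t])
    show "(\<lambda>t. (unit \<bullet> (k \<star> b)) \<bullet> t) \<in> linear_maps K HA.T HA.T"
      "(\<lambda>t. unit \<bullet> ((k \<star> b) \<bullet> t)) \<in> linear_maps K HA.T HA.T"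
      by (intro linear linear_id; simp)+
  qed (simp add: pure)
  moreover have "(\<lambda>s. (unit \<bullet> s) \<bullet> t) \<in> linear_maps K HA.T HA.T"
    "(\<lambda>s. unit \<bullet> (s \<bullet> t)) \<in> linear_maps K HA.T HA.T"
    by (intro linear linear_id; simp add: t)+
  ultimately show ?thesis
    using HA.linear_eq_on_pure[OF _ _ _ s, of "\<lambda>s. (unit \<bullet> s) \<bullet> t" HA.T "\<lambda>s. unit \<bullet> (s \<bullet> t)"]
    by blast
qed

lemma unit_smash_one_pure:
  assumes [simp]: "a \<in> carrier A"
  shows "unit \<bullet> (\<one>\<^bsub>H\<^esub> \<star> a) = \<one>\<^bsub>H\<^esub> \<star> a"
proof -
  have "unit \<bullet> (\<one>\<^bsub>H\<^esub> \<star> a) = \<one>\<^bsub>H\<^esub> \<star> (act \<one>\<^bsub>A\<^esub> \<one>\<^bsub>H\<^esub> \<otimes>\<^bsub>A\<^esub> a)"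
    unfolding unit_smash_pure[OF one_closed assms]
    by (rule sw_one; (intro action_rules)?; simp)
  then show ?thesis by simp
qed

lemma smash_factor:
  assumes [simp]: "h \<in> carrier H" "a \<in> carrier A"
  shows "(unit \<bullet> (h \<star> \<one>\<^bsub>A\<^esub>)) \<bullet> (unit \<bullet> (\<one>\<^bsub>H\<^esub> \<star> a)) = unit \<bullet> (h \<star> a)"
proof -
  have "(h \<star> \<one>\<^bsub>A\<^esub>) \<bullet> (\<one>\<^bsub>H\<^esub> \<star> a) = smash_pure_tensors h \<one>\<^bsub>A\<^esub> \<one>\<^bsub>H\<^esub> a"
    by (simp add: smash_pure)
  also have "\<dots> = (\<one>\<^bsub>H\<^esub> \<otimes>\<^bsub>H\<^esub> h) \<star> (act \<one>\<^bsub>A\<^esub> \<one>\<^bsub>H\<^esub> \<otimes>\<^bsub>A\<^esub> a)"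
    by (rule sw_one; (intro action_rules)?; simp)
  finally show ?thesis by (simp add: smash_unit_assoc unit_smash_one_pure)
qed

end


section \<open>The universal property\<close>

locale opposite_covariant =
  right_partial_op_action K H A act + opcop_partial_representation K H B \<gamma>
  for K :: "('k, 'r) ring_scheme" (structure)
    and H :: "('k, 'h, 'm) hopf_algebra_scheme" (structure)
    and A :: "('k, 'a, 'n) module_scheme" (structure)
    and B :: "('k, 'b, 'l) module_scheme" (structure)
    and act :: "'a \<Rightarrow> 'h \<Rightarrow> 'a" and \<gamma> :: "'h \<Rightarrow> 'b" +
  fixes \<phi> :: "'a \<Rightarrow> 'b"
  assumes covariant: "opposite_covariant_pair K H A B act \<phi> \<gamma>"
begin

lemma phi_linear: "\<phi> \<in> linear_maps K A B"
  and phi_hom: "\<phi> \<in> ring_hom A B"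
  using covariant by (simp_all add: opposite_covariant_pair_def algebra_morphisms_def)

lemma phi_closed [simp]: "a \<in> carrier A \<Longrightarrow> \<phi> a \<in> carrier B"
  and phi_one [simp]: "\<phi> \<one>\<^bsub>A\<^esub> = \<one>\<^bsub>B\<^esub>"
  and phi_mult: "a \<in> carrier A \<Longrightarrow> b \<in> carrier A \<Longrightarrow> \<phi> (a \<otimes>\<^bsub>A\<^esub> b) = \<phi> a \<otimes>\<^bsub>B\<^esub> \<phi> b"
  by (rule ring_hom_closed[OF phi_hom] ring_hom_one[OF phi_hom] ring_hom_mult[OF phi_hom]; assumption)+

lemmas pair_rules = action_rules gamma_rules linear_comp[OF phi_linear]

lemma phi_act:
  assumes [simp]: "a \<in> carrier A" "h \<in> carrier H"
  shows "\<phi> (act a h) = sw B (\<lambda>x y. \<gamma> (Si x) \<otimes>\<^bsub>B\<^esub> \<phi> a \<otimes>\<^bsub>B\<^esub> \<gamma> y) h"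
proof -
  have "\<phi> (act a h) = sweedler (hopf_opcop K H) B (\<lambda>x y. \<gamma> (Si y) \<otimes>\<^bsub>B\<^esub> \<phi> a \<otimes>\<^bsub>B\<^esub> \<gamma> x) h"
    using covariant by (simp add: opposite_covariant_pair_def)
  also have "\<dots> = sw B (\<lambda>x y. \<gamma> (Si x) \<otimes>\<^bsub>B\<^esub> \<phi> a \<otimes>\<^bsub>B\<^esub> \<gamma> y) h"
    by (rule sweedler_opcop; (intro pair_rules)?; simp)
  finally show ?thesis .
qed

lemma phi_commutes:
  assumes [simp]: "a \<in> carrier A" "h \<in> carrier H"
  shows "sw B (\<lambda>x y. \<gamma> x \<otimes>\<^bsub>B\<^esub> \<gamma> (Si y) \<otimes>\<^bsub>B\<^esub> \<phi> a) h = sw B (\<lambda>x y. \<phi> a \<otimes>\<^bsub>B\<^esub> \<gamma> x \<otimes>\<^bsub>B\<^esub> \<gamma> (Si y)) h"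
proof -
  have "sw B (\<lambda>x y. \<gamma> x \<otimes>\<^bsub>B\<^esub> \<gamma> (Si y) \<otimes>\<^bsub>B\<^esub> \<phi> a) h
    = sweedler (hopf_opcop K H) B (\<lambda>x y. \<gamma> y \<otimes>\<^bsub>B\<^esub> \<gamma> (Si x) \<otimes>\<^bsub>B\<^esub> \<phi> a) h"
    by (rule sweedler_opcop[symmetric]; (intro pair_rules)?; simp)
  also have "\<dots> = sweedler (hopf_opcop K H) B (\<lambda>x y. \<phi> a \<otimes>\<^bsub>B\<^esub> \<gamma> y \<otimes>\<^bsub>B\<^esub> \<gamma> (Si x)) h"
    using covariant by (simp add: opposite_covariant_pair_def)
  also have "\<dots> = sw B (\<lambda>x y. \<phi> a \<otimes>\<^bsub>B\<^esub> \<gamma> x \<otimes>\<^bsub>B\<^esub> \<gamma> (Si y)) h"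
    by (rule sweedler_opcop; (intro pair_rules)?; simp)
  finally show ?thesis .
qed

text \<open>The multiplicativity of \<open>\<Gamma>\<close> on pure tensors, up to a right factor: the left side is
  \<open>\<gamma>(h\<^sub>1 k) \<gamma>(Si h\<^sub>2) \<phi>(b) \<gamma>(h\<^sub>3)\<close>, in which the product \<open>\<gamma>(h\<^sub>1 k) \<gamma>(Si h\<^sub>2)\<close> first releases \<open>\<gamma>(k)\<close>, then
  moves past \<open>\<phi>(b)\<close>, and finally disappears into \<open>\<gamma>(h\<^sub>3)\<close>.\<close>

lemma gamma_phi_act:
  assumes [simp]: "h \<in> carrier H" "k \<in> carrier H" "b \<in> carrier A"
  shows "sw B (\<lambda>x y. \<gamma> (x \<otimes>\<^bsub>H\<^esub> k) \<otimes>\<^bsub>B\<^esub> \<phi> (act b y)) h = \<gamma> k \<otimes>\<^bsub>B\<^esub> \<phi> b \<otimes>\<^bsub>B\<^esub> \<gamma> h"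
proof -
  note left = sw_mult_left[OF B.unital_algebra_axioms]
    and right = sw_mult_right[OF B.unital_algebra_axioms]
  let ?m = "\<lambda>x u. \<gamma> (x \<otimes>\<^bsub>H\<^esub> k) \<otimes>\<^bsub>B\<^esub> \<gamma> (Si u)"
    and ?c = "\<gamma> k \<otimes>\<^bsub>B\<^esub> \<phi> b"
  have expand: "\<gamma> (x \<otimes>\<^bsub>H\<^esub> k) \<otimes>\<^bsub>B\<^esub> \<phi> (act b y) = sw B (\<lambda>u v. ?m x u \<otimes>\<^bsub>B\<^esub> (\<phi> b \<otimes>\<^bsub>B\<^esub> \<gamma> v)) y"
    if [simp]: "x \<in> carrier H" "y \<in> carrier H" for x y
  proof -
    have "\<gamma> (x \<otimes>\<^bsub>H\<^esub> k) \<otimes>\<^bsub>B\<^esub> \<phi> (act b y)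
      = sw B (\<lambda>u v. \<gamma> (x \<otimes>\<^bsub>H\<^esub> k) \<otimes>\<^bsub>B\<^esub> (\<gamma> (Si u) \<otimes>\<^bsub>B\<^esub> \<phi> b \<otimes>\<^bsub>B\<^esub> \<gamma> v)) y"
      unfolding phi_act[OF \<open>b \<in> carrier A\<close> \<open>y \<in> carrier H\<close>]
      by (rule left; (intro pair_rules)?; simp)
    also have "\<dots> = sw B (\<lambda>u v. ?m x u \<otimes>\<^bsub>B\<^esub> (\<phi> b \<otimes>\<^bsub>B\<^esub> \<gamma> v)) y"
      by (rule sw_cong; (intro pair_rules)?; simp add: B.m_assoc)
    finally show ?thesis .
  qed
  have move: "sw B (\<lambda>x u. ?m x u \<otimes>\<^bsub>B\<^esub> (\<phi> b \<otimes>\<^bsub>B\<^esub> \<gamma> v)) z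
    = sw B (\<lambda>x u. ?c \<otimes>\<^bsub>B\<^esub> (\<gamma> x \<otimes>\<^bsub>B\<^esub> \<gamma> (Si u) \<otimes>\<^bsub>B\<^esub> \<gamma> v)) z"
    if [simp]: "z \<in> carrier H" "v \<in> carrier H" for z v
  proof -
    have "sw B (\<lambda>x u. ?m x u \<otimes>\<^bsub>B\<^esub> (\<phi> b \<otimes>\<^bsub>B\<^esub> \<gamma> v)) z = sw B ?m z \<otimes>\<^bsub>B\<^esub> (\<phi> b \<otimes>\<^bsub>B\<^esub> \<gamma> v)"
      by (rule right[symmetric]; (intro pair_rules)?; simp)
    also have "sw B ?m z = sw B (\<lambda>x u. \<gamma> k \<otimes>\<^bsub>B\<^esub> \<gamma> x \<otimes>\<^bsub>B\<^esub> \<gamma> (Si u)) z"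
      by (rule gamma_mult_absorb) simp_all
    also have "\<dots> \<otimes>\<^bsub>B\<^esub> (\<phi> b \<otimes>\<^bsub>B\<^esub> \<gamma> v)
      = sw B (\<lambda>x u. \<gamma> k \<otimes>\<^bsub>B\<^esub> \<gamma> x \<otimes>\<^bsub>B\<^esub> \<gamma> (Si u) \<otimes>\<^bsub>B\<^esub> (\<phi> b \<otimes>\<^bsub>B\<^esub> \<gamma> v)) z"
      by (rule right; (intro pair_rules)?; simp)
    also have "\<dots> = sw B (\<lambda>x u. \<gamma> k \<otimes>\<^bsub>B\<^esub> (\<gamma> x \<otimes>\<^bsub>B\<^esub> \<gamma> (Si u) \<otimes>\<^bsub>B\<^esub> \<phi> b) \<otimes>\<^bsub>B\<^esub> \<gamma> v) z"
      by (rule sw_cong; (intro pair_rules)?; simp add: B.m_assoc)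
    also have "\<dots> = sw B (\<lambda>x u. \<gamma> k \<otimes>\<^bsub>B\<^esub> (\<gamma> x \<otimes>\<^bsub>B\<^esub> \<gamma> (Si u) \<otimes>\<^bsub>B\<^esub> \<phi> b)) z \<otimes>\<^bsub>B\<^esub> \<gamma> v"
      by (rule right[symmetric]; (intro pair_rules)?; simp)
    also have "sw B (\<lambda>x u. \<gamma> k \<otimes>\<^bsub>B\<^esub> (\<gamma> x \<otimes>\<^bsub>B\<^esub> \<gamma> (Si u) \<otimes>\<^bsub>B\<^esub> \<phi> b)) z
      = \<gamma> k \<otimes>\<^bsub>B\<^esub> sw B (\<lambda>x u. \<gamma> x \<otimes>\<^bsub>B\<^esub> \<gamma> (Si u) \<otimes>\<^bsub>B\<^esub> \<phi> b) z"
      by (rule left[symmetric]; (intro pair_rules)?; simp)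
    also have "sw B (\<lambda>x u. \<gamma> x \<otimes>\<^bsub>B\<^esub> \<gamma> (Si u) \<otimes>\<^bsub>B\<^esub> \<phi> b) z = sw B (\<lambda>x u. \<phi> b \<otimes>\<^bsub>B\<^esub> \<gamma> x \<otimes>\<^bsub>B\<^esub> \<gamma> (Si u)) z"
      by (rule phi_commutes) simp_all
    also have "\<gamma> k \<otimes>\<^bsub>B\<^esub> sw B (\<lambda>x u. \<phi> b \<otimes>\<^bsub>B\<^esub> \<gamma> x \<otimes>\<^bsub>B\<^esub> \<gamma> (Si u)) z
      = sw B (\<lambda>x u. \<gamma> k \<otimes>\<^bsub>B\<^esub> (\<phi> b \<otimes>\<^bsub>B\<^esub> \<gamma> x \<otimes>\<^bsub>B\<^esub> \<gamma> (Si u))) z"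
      by (rule left; (intro pair_rules)?; simp)
    also have "\<dots> \<otimes>\<^bsub>B\<^esub> \<gamma> v
      = sw B (\<lambda>x u. \<gamma> k \<otimes>\<^bsub>B\<^esub> (\<phi> b \<otimes>\<^bsub>B\<^esub> \<gamma> x \<otimes>\<^bsub>B\<^esub> \<gamma> (Si u)) \<otimes>\<^bsub>B\<^esub> \<gamma> v) z"
      by (rule right; (intro pair_rules)?; simp)
    also have "\<dots> = sw B (\<lambda>x u. ?c \<otimes>\<^bsub>B\<^esub> (\<gamma> x \<otimes>\<^bsub>B\<^esub> \<gamma> (Si u) \<otimes>\<^bsub>B\<^esub> \<gamma> v)) z"
      by (rule sw_cong; (intro pair_rules)?; simp add: B.m_assoc)
    finally show ?thesis .
  qed
  have "sw B (\<lambda>x y. \<gamma> (x \<otimes>\<^bsub>H\<^esub> k) \<otimes>\<^bsub>B\<^esub> \<phi> (act b y)) h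
    = sw B (\<lambda>x y. sw B (\<lambda>u v. ?m x u \<otimes>\<^bsub>B\<^esub> (\<phi> b \<otimes>\<^bsub>B\<^esub> \<gamma> v)) y) h"
    by (rule sw_cong; (intro pair_rules)?; (rule expand)?; simp)
  also have "\<dots> = sw B (\<lambda>z v. sw B (\<lambda>x u. ?m x u \<otimes>\<^bsub>B\<^esub> (\<phi> b \<otimes>\<^bsub>B\<^esub> \<gamma> v)) z) h"
    by (rule sw_coassoc[symmetric]; (intro pair_rules)?; simp)
  also have "\<dots> = sw B (\<lambda>z v. sw B (\<lambda>x u. ?c \<otimes>\<^bsub>B\<^esub> (\<gamma> x \<otimes>\<^bsub>B\<^esub> \<gamma> (Si u) \<otimes>\<^bsub>B\<^esub> \<gamma> v)) z) h"
    by (rule sw_cong; (intro pair_rules)?; (rule move)?; simp)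
  also have "\<dots> = sw B (\<lambda>x y. sw B (\<lambda>u v. ?c \<otimes>\<^bsub>B\<^esub> (\<gamma> x \<otimes>\<^bsub>B\<^esub> \<gamma> (Si u) \<otimes>\<^bsub>B\<^esub> \<gamma> v)) y) h"
    by (rule sw_coassoc; (intro pair_rules)?; simp)
  also have "\<dots> = sw B (\<lambda>x y. ?c \<otimes>\<^bsub>B\<^esub> sw B (\<lambda>u v. \<gamma> x \<otimes>\<^bsub>B\<^esub> \<gamma> (Si u) \<otimes>\<^bsub>B\<^esub> \<gamma> v) y) h"
    by (rule sw_cong; (rule left[symmetric])?; (intro pair_rules)?; simp)
  also have "\<dots> = ?c \<otimes>\<^bsub>B\<^esub> sw B (\<lambda>x y. sw B (\<lambda>u v. \<gamma> x \<otimes>\<^bsub>B\<^esub> \<gamma> (Si u) \<otimes>\<^bsub>B\<^esub> \<gamma> v) y) h"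
    by (rule left[symmetric]; (intro pair_rules)?; simp)
  finally show ?thesis by (simp add: gamma_regular)
qed

definition \<Gamma> where "\<Gamma> = tensor_lift B (\<lambda>h a. \<gamma> h \<otimes>\<^bsub>B\<^esub> \<phi> a)"

lemma gamma_phi_bilinear: "(\<lambda>h a. \<gamma> h \<otimes>\<^bsub>B\<^esub> \<phi> a) \<in> bilinear_maps K H A B"
  by (intro pair_rules; simp)

lemma Gamma_linear: "\<Gamma> \<in> linear_maps K HA.T B"
  unfolding \<Gamma>_def by (rule HA.tensor_lift_linear[OF _ gamma_phi_bilinear]) simp

lemma Gamma_closed [simp]: "t \<in> carrier HA.T \<Longrightarrow> \<Gamma> t \<in> carrier B"
  by (rule linear_closed[OF Gamma_linear])

lemma Gamma_pure: "h \<in> carrier H \<Longrightarrow> a \<in> carrier A \<Longrightarrow> \<Gamma> (h \<star> a) = \<gamma> h \<otimes>\<^bsub>B\<^esub> \<phi> a"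
  unfolding \<Gamma>_def by (rule HA.tensor_lift_pure[OF _ gamma_phi_bilinear]) simp_all

lemma Gamma_mult:
  assumes s: "s \<in> carrier HA.T" and t: "t \<in> carrier HA.T"
  shows "\<Gamma> (s \<bullet> t) = \<Gamma> s \<otimes>\<^bsub>B\<^esub> \<Gamma> t"
proof -
  have pure: "\<Gamma> ((k \<star> b) \<bullet> (h \<star> a)) = \<Gamma> (k \<star> b) \<otimes>\<^bsub>B\<^esub> \<Gamma> (h \<star> a)"
    if [simp]: "k \<in> carrier H" "b \<in> carrier A" "h \<in> carrier H" "a \<in> carrier A" for k b h a
  proof -
    have "\<Gamma> ((k \<star> b) \<bullet> (h \<star> a)) = sw B (\<lambda>x y. \<Gamma> ((x \<otimes>\<^bsub>H\<^esub> k) \<star> (act b y \<otimes>\<^bsub>A\<^esub> a))) h"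
      unfolding smash_pure[OF that]
      by (rule linear_sw[OF _ _ _ _ Gamma_linear]; (intro action_rules)?; simp)
    also have "\<dots> = sw B (\<lambda>x y. \<gamma> (x \<otimes>\<^bsub>H\<^esub> k) \<otimes>\<^bsub>B\<^esub> \<phi> (act b y) \<otimes>\<^bsub>B\<^esub> \<phi> a) h"
      by (rule sw_cong; (intro bilinear_comp[OF Gamma_linear] action_rules)?;
          simp add: Gamma_pure phi_mult B.m_assoc)
    also have "\<dots> = sw B (\<lambda>x y. \<gamma> (x \<otimes>\<^bsub>H\<^esub> k) \<otimes>\<^bsub>B\<^esub> \<phi> (act b y)) h \<otimes>\<^bsub>B\<^esub> \<phi> a"
      by (rule sw_mult_right[OF B.unital_algebra_axioms, symmetric]; (intro pair_rules)?; simp)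
    finally show ?thesis by (simp add: gamma_phi_act Gamma_pure B.m_assoc)
  qed
  note linear = linear_comp[OF Gamma_linear] B.linear_mult_left B.linear_mult_right
    linear_smash_left linear_smash_right linear_id
  have "\<Gamma> ((k \<star> b) \<bullet> t) = \<Gamma> (k \<star> b) \<otimes>\<^bsub>B\<^esub> \<Gamma> t"
    if [simp]: "k \<in> carrier H" "b \<in> carrier A" for k b
  proof (rule HA.linear_eq_on_pure[OF _ _ _ t])
    show "(\<lambda>t. \<Gamma> ((k \<star> b) \<bullet> t)) \<in> linear_maps K HA.T B"
      "(\<lambda>t. \<Gamma> (k \<star> b) \<otimes>\<^bsub>B\<^esub> \<Gamma> t) \<in> linear_maps K HA.T B"
      by (intro linear; simp)+
  qed (simp add: pure)
  moreover have "(\<lambda>s. \<Gamma> (s \<bullet> t)) \<in> linear_maps K HA.T B"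
    "(\<lambda>s. \<Gamma> s \<otimes>\<^bsub>B\<^esub> \<Gamma> t) \<in> linear_maps K HA.T B"
    by (intro linear; simp add: t)+
  ultimately show ?thesis
    using HA.linear_eq_on_pure[OF _ _ _ s, of "\<lambda>s. \<Gamma> (s \<bullet> t)" B "\<lambda>s. \<Gamma> s \<otimes>\<^bsub>B\<^esub> \<Gamma> t"]
    by blast
qed

abbreviation W where "W \<equiv> partial_smash_product K (hopf_op H) A act"

lemma W_sel [simp]: "carrier W = (\<lambda>t. unit \<bullet> t) ` carrier HA.T" "mult W = smash"
  "add W = add HA.T" "smult W = smult HA.T" "\<one>\<^bsub>W\<^esub> = unit \<bullet> unit"
  by (simp_all add: partial_smash_product_def smash_elem_eq)

text \<open>The element \<open>1 \<otimes> 1\<close>, which is not a unit of \<open>H \<otimes> A\<close> in general, is sent to \<open>1\<close>. So \<open>\<Gamma>\<close> does not see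
  the projection onto the smash product.\<close>

lemma Gamma_unit_smash: "t \<in> carrier HA.T \<Longrightarrow> \<Gamma> (unit \<bullet> t) = \<Gamma> t"
  by (simp add: Gamma_mult Gamma_pure)

lemma W_closed:
  assumes "s \<in> carrier W" "t \<in> carrier W"
  shows "s \<bullet> t \<in> carrier W" "s \<oplus>\<^bsub>HA.T\<^esub> t \<in> carrier W"
    and "c \<in> carrier K \<Longrightarrow> c \<odot>\<^bsub>HA.T\<^esub> s \<in> carrier W"
proof -
  interpret T: module K HA.T by (rule HA.module_T)
  obtain s' t' where s: "s = unit \<bullet> s'" "s' \<in> carrier HA.T" and t: "t = unit \<bullet> t'" "t' \<in> carrier HA.T"
    using assms by auto
  note lin = linear_smash_right[of unit]
  show "s \<bullet> t \<in> carrier W"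
    using s t by (simp add: smash_unit_assoc)
  show "s \<oplus>\<^bsub>HA.T\<^esub> t \<in> carrier W"
    using s t linear_add[OF lin, of s' t'] by (auto intro!: image_eqI[of _ _ "s' \<oplus>\<^bsub>HA.T\<^esub> t'"])
  show "c \<odot>\<^bsub>HA.T\<^esub> s \<in> carrier W" if "c \<in> carrier K"
    using s that linear_smult[OF lin that, of s'] by (auto intro!: image_eqI[of _ _ "c \<odot>\<^bsub>HA.T\<^esub> s'"])
qed

lemma W_carrier_T: "t \<in> carrier W \<Longrightarrow> t \<in> carrier HA.T"
  by auto

lemma Gamma_morphism: "restrict \<Gamma> (carrier W) \<in> algebra_morphisms K W B"
proof -
  have one: "unit \<bullet> unit \<in> carrier W" by simp
  note [simp del] = W_sel(1)
  have "restrict \<Gamma> (carrier W) \<in> ring_hom W B"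
  proof (rule ring_hom_memI)
    show "restrict \<Gamma> (carrier W) \<one>\<^bsub>W\<^esub> = \<one>\<^bsub>B\<^esub>"
      using one by (simp add: Gamma_unit_smash Gamma_pure)
  qed (simp_all add: W_closed W_carrier_T Gamma_mult linear_add[OF Gamma_linear])
  moreover have "restrict \<Gamma> (carrier W) \<in> linear_maps K W B"
    by (rule linear_mapsI)
      (simp_all add: W_closed W_carrier_T linear_add[OF Gamma_linear] linear_smult[OF Gamma_linear])
  ultimately show ?thesis by (simp add: algebra_morphisms_def)
qed

text \<open>A morphism is determined on \<open>h # a\<close> by the factorisation \<open>(h # 1)(1 # a)\<close>, and the remaining elements
  are sums of such.\<close>

lemma Gamma_unique:
  assumes G: "G \<in> algebra_morphisms K W B"
    and phi: "\<And>a. a \<in> carrier A \<Longrightarrow> G (unit \<bullet> (\<one>\<^bsub>H\<^esub> \<star> a)) = \<phi> a"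
    and gamma: "\<And>h. h \<in> carrier H \<Longrightarrow> G (unit \<bullet> (h \<star> \<one>\<^bsub>A\<^esub>)) = \<gamma> h"
    and t: "t \<in> carrier HA.T"
  shows "G (unit \<bullet> t) = \<Gamma> t"
proof -
  have hom: "G \<in> ring_hom W B" and lin: "G \<in> linear_maps K W B"
    using G by (simp_all add: algebra_morphisms_def)
  have corestrict: "(\<lambda>t. unit \<bullet> t) \<in> linear_maps K HA.T W"
    using linear_smash_right[of unit] by (simp add: linear_maps_def)
  show ?thesis
  proof (rule HA.linear_eq_on_pure[OF _ Gamma_linear _ t])
    show "(\<lambda>t. G (unit \<bullet> t)) \<in> linear_maps K HA.T B"
      by (rule linear_comp[OF lin corestrict])
    fix h a assume [simp]: "h \<in> carrier H" "a \<in> carrier A"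
    have "G (unit \<bullet> (h \<star> a)) = G ((unit \<bullet> (h \<star> \<one>\<^bsub>A\<^esub>)) \<bullet> (unit \<bullet> (\<one>\<^bsub>H\<^esub> \<star> a)))"
      by (simp add: smash_factor)
    also have "\<dots> = G (unit \<bullet> (h \<star> \<one>\<^bsub>A\<^esub>)) \<otimes>\<^bsub>B\<^esub> G (unit \<bullet> (\<one>\<^bsub>H\<^esub> \<star> a))"
      using ring_hom_mult[OF hom, of "unit \<bullet> (h \<star> \<one>\<^bsub>A\<^esub>)" "unit \<bullet> (\<one>\<^bsub>H\<^esub> \<star> a)"] by simp
    also have "\<dots> = \<Gamma> (h \<star> a)" by (simp add: phi gamma Gamma_pure)
    finally show "G (unit \<bullet> (h \<star> a)) = \<Gamma> (h \<star> a)" .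
  qed
qed

end

theorem theorem2p33:
  fixes K :: "('k, 'r) ring_scheme"
    and H :: "('k, 'h, 'm) hopf_algebra_scheme"
    and A :: "('k, 'a, 'n) module_scheme"
    and B :: "('k, 'b, 'l) module_scheme"
    and act :: "'a \<Rightarrow> 'h \<Rightarrow> 'a"
    and \<phi> :: "'a \<Rightarrow> 'b" and \<gamma> :: "'h \<Rightarrow> 'b"
  assumes "field K"
    and "hopf_algebra K H"
    and "bij_betw (antipode H) (carrier H) (carrier H)"
    and "unital_algebra K A"
    and "unital_algebra K B"
    and "right_partial_action K (hopf_op H) A act"
    and "opposite_covariant_pair K H A B act \<phi> \<gamma>"
  shows "\<exists>!\<Gamma>. \<Gamma> \<in> extensional (carrier (partial_smash_product K (hopf_op H) A act))
    \<and> \<Gamma> \<in> algebra_morphisms K (partial_smash_product K (hopf_op H) A act) B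
    \<and> (\<forall>a\<in>carrier A. \<phi> a = \<Gamma> (smash_elem K (hopf_op H) A act \<one>\<^bsub>H\<^esub> a))
    \<and> (\<forall>h\<in>carrier H. \<gamma> h = \<Gamma> (smash_elem K (hopf_op H) A act h \<one>\<^bsub>A\<^esub>))"
proof -
  have "partial_representation K (hopf_opcop K H) B \<gamma>"
    using assms(7) by (simp add: opposite_covariant_pair_def)
  with assms interpret opposite_covariant K H A B act \<gamma> \<phi>
    by (intro opposite_covariant.intro right_partial_op_action.intro
        right_partial_op_action_axioms.intro opcop_partial_representation.intro
        opcop_partial_representation_axioms.intro hopf_bijective_antipode.intro
        hopf_bijective_antipode_axioms.intro opposite_covariant_axioms.intro)
  show ?thesis
  proof (rule ex1I[of _ "restrict \<Gamma> (carrier W)"], intro conjI ballI)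
    show "restrict \<Gamma> (carrier W) \<in> algebra_morphisms K W B" by (rule Gamma_morphism)
    show "\<phi> a = restrict \<Gamma> (carrier W) (smash_elem K (hopf_op H) A act \<one>\<^bsub>H\<^esub> a)"
      if "a \<in> carrier A" for a
      using that by (simp add: smash_elem_eq Gamma_unit_smash Gamma_pure)
    show "\<gamma> h = restrict \<Gamma> (carrier W) (smash_elem K (hopf_op H) A act h \<one>\<^bsub>A\<^esub>)"
      if "h \<in> carrier H" for h
      using that by (simp add: smash_elem_eq Gamma_unit_smash Gamma_pure)
  next
    fix G
    assume "G \<in> extensional (carrier W) \<and> G \<in> algebra_morphisms K W B \<and>
      (\<forall>a\<in>carrier A. \<phi> a = G (smash_elem K (hopf_op H) A act \<one>\<^bsub>H\<^esub> a)) \<and>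
      (\<forall>h\<in>carrier H. \<gamma> h = G (smash_elem K (hopf_op H) A act h \<one>\<^bsub>A\<^esub>))"
    then have ext: "G \<in> extensional (carrier W)" and eq: "\<And>t. t \<in> carrier HA.T \<Longrightarrow> G (unit \<bullet> t) = \<Gamma> t"
      by (auto simp: smash_elem_eq intro!: Gamma_unique)
    show "G = restrict \<Gamma> (carrier W)"
      by (rule extensionalityI[OF ext restrict_extensional])
        (auto simp: eq Gamma_unit_smash)
  qed simp
qed

end
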